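(* Let $K$ be a commutative unital ring, let $S,T$ be two $K$-algebras, and let $\pi:S\to T$ be a surjective homomorphism of $K$-algebras. Let $L:S\to S$ be an LDO of order $k$ which, for every $h\in|T|$, is of order $k$ at $h\circ\pi$ and elliptic at $h\circ\pi$. If $L':T\to T$ is a $K$-linear map such that $\pi\circ L=L'\circ\pi$, then $L'$ is an elliptic LDO of order $k$.
   Context: All algebras are commutative, associative and unital $K$-algebras, and homomorphisms of algebras are unital. For a $K$-algebra $A$, $|A|$ is the set of all $K$-algebra homomorphisms $h:A\to K$ ($K$-points). LDO: for a $K$-linear map $F:A\to A$ and $f\in A$, let $(\delta(f)F)(p)=F(fp)-fF(p)$. A $K$-linear map $L:A\to A$ is a linear differential operator (LDO) of order $\leqslant k$ if $\delta(f_0)\cdots\delta(f_k)L=0$ for all $f_0,\dots,f_k\in A$; it is of order $k$ if it is of order $\leqslant k$ but not of order $\leqslant k-1$. Universal $h$-derivation: for $h\in|A|$, an $h$-derivation with values in a $K$-module $M$ is a $K$-linear map $D:A\to M$ with $D(fg)=h(f)D(g)+h(g)D(f)$. $(\Omega_h,d_h)$ denotes the universal $h$-derivation: a $K$-module $\Omega_h$ with an $h$-derivation $d_h:A\to\Omega_h$ through which every $h$-derivation factors by a unique $K$-linear map. (One model: $\Omega_h=I_h/I_h^2$ with $I_h=\ker h$ and $d_h(f)=[f-h(f)]$.) Principal symbol: for $G:A\to K$ $K$-linear and $f\in A$, let $(\delta_h(f)G)(p)=G(fp)-h(f)G(p)$, and for $L:A\to A$ put $L_h=h\circ L$. For an LDO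 $L:A\to A$ of order $\leqslant k$ and $h\in|A|$, the principal symbol of $L$ at $h$ is (after identifying $A/I_h$ with $K$ via $h$) the $K$-linear functional $\sigma_{L,h}:(\Omega_h)^{\odot k}\to K$ on the $k$-th symmetric power determined by $$\sigma_{L,h}(d_h(f_1)\odot\cdots\odot d_h(f_k))=(\delta_h(f_1)\cdots\delta_h(f_k)L_h)(1_A),\qquad f_1,\dots,f_k\in A.$$ Ellipticity: let $L:A\to A$ be an LDO of order $k$ and $h\in|A|$. $L$ is of order $k$ at $h$ if $\sigma_{L,h}\neq0$. $L$ is elliptic at $h$ if it is of order $k$ at $h$ and for every non-zero $\alpha\in\Omega_h$ the map $K\to K$, $c\mapsto c\,\sigma_{L,h}(\alpha^{\odot k})$, is injective. $L$ is elliptic if it is elliptic at every $h\in|A|$.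
   Formalization: If |T| is empty, only "L' is an LDO of order ≤ k" is asserted; exact order k and ellipticity are asserted for non-empty |T|. The original fails otherwise: K=ℝ, S=ℝ[x], T=ℂ=ℝ[x]/(x²+1), L=(x²+1)d/dx, L'=0. *)

theory Defs
  imports "HOL-Algebra.Module" "HOL-Algebra.Ideal_Product" "HOL-Library.Multiset"
begin

section \<open>Linear maps, algebra homomorphisms and points\<close>

text \<open>Functions are only constrained on carriers (except for extensionality of the symbol below). The fields mult and one of a record that is used
  merely as a module are irrelevant and left undefined.\<close>

definition lin_maps ::
  "('k,'m) ring_scheme \<Rightarrow> ('k,'a,'p) module_scheme \<Rightarrow> ('k,'b,'q) module_scheme \<Rightarrow> ('a \<Rightarrow> 'b) set"
  where "lin_maps K M N = {F \<in> carrier M \<rightarrow> carrier N.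
    (\<forall>x\<in>carrier M. \<forall>y\<in>carrier M. F (x \<oplus>\<^bsub>M\<^esub> y) = F x \<oplus>\<^bsub>N\<^esub> F y) \<and>
    (\<forall>c\<in>carrier K. \<forall>x\<in>carrier M. F (c \<odot>\<^bsub>M\<^esub> x) = c \<odot>\<^bsub>N\<^esub> F x)}"

definition alg_homs ::
  "('k,'m) ring_scheme \<Rightarrow> ('k,'a,'p) module_scheme \<Rightarrow> ('k,'b,'q) module_scheme \<Rightarrow> ('a \<Rightarrow> 'b) set"
  where "alg_homs K A B = ring_hom A B \<inter> lin_maps K A B"

text \<open>The ring \<open>K\<close> as an algebra over itself.\<close>

definition ground :: "('k,'m) ring_scheme \<Rightarrow> ('k,'k) module"
  where "ground K = \<lparr>carrier = carrier K, monoid.mult = monoid.mult K, one = one K,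
                     zero = zero K, add = add K, smult = monoid.mult K\<rparr>"

definition points :: "('k,'m) ring_scheme \<Rightarrow> ('k,'a,'p) module_scheme \<Rightarrow> ('a \<Rightarrow> 'k) set"
  where "points K A = alg_homs K A (ground K)"


section \<open>Linear differential operators\<close>

definition dlt :: "('k,'a,'p) module_scheme \<Rightarrow> 'a \<Rightarrow> ('a \<Rightarrow> 'a) \<Rightarrow> 'a \<Rightarrow> 'a"
  where "dlt A f F = (\<lambda>p. F (f \<otimes>\<^bsub>A\<^esub> p) \<ominus>\<^bsub>A\<^esub> f \<otimes>\<^bsub>A\<^esub> F p)"

text \<open>Order \<open>< n\<close>: all \<open>n\<close>-fold commutators vanish. So order \<open>\<le> k\<close> is order \<open>< k + 1\<close>, and order
  \<open>< 0\<close> (that is, order \<open>\<le> -1\<close>, the empty product of commutators) means that the operator is zero.\<close>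

definition ldo_order_less ::
  "('k,'m) ring_scheme \<Rightarrow> ('k,'a,'p) module_scheme \<Rightarrow> nat \<Rightarrow> ('a \<Rightarrow> 'a) \<Rightarrow> bool"
  where "ldo_order_less K A n L \<longleftrightarrow> L \<in> lin_maps K A A \<and>
    (\<forall>fs. length fs = n \<and> set fs \<subseteq> carrier A \<longrightarrow>
      (\<forall>p\<in>carrier A. foldr (dlt A) fs L p = \<zero>\<^bsub>A\<^esub>))"

definition ldo_order_le ::
  "('k,'m) ring_scheme \<Rightarrow> ('k,'a,'p) module_scheme \<Rightarrow> nat \<Rightarrow> ('a \<Rightarrow> 'a) \<Rightarrow> bool"
  where "ldo_order_le K A k L \<longleftrightarrow> ldo_order_less K A (Suc k) L"

definition ldo_of_order ::
  "('k,'m) ring_scheme \<Rightarrow> ('k,'a,'p) module_scheme \<Rightarrow> nat \<Rightarrow> ('a \<Rightarrow> 'a) \<Rightarrow> bool"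
  where "ldo_of_order K A k L \<longleftrightarrow> ldo_order_le K A k L \<and> \<not> ldo_order_less K A k L"


section \<open>Quotient modules and the universal derivation at a point\<close>

definition quot_mod :: "('k,'a,'p) module_scheme \<Rightarrow> 'a set \<Rightarrow> ('k,'a set) module"
  where "quot_mod M N = \<lparr>carrier = a_rcosets\<^bsub>M\<^esub> N, monoid.mult = undefined, one = undefined,
    zero = N, add = set_add M, smult = (\<lambda>c X. \<Union>x\<in>X. N +>\<^bsub>M\<^esub> (c \<odot>\<^bsub>M\<^esub> x))\<rparr>"

text \<open>The model \<open>\<Omega>\<^sub>h = I / I\<^sup>2\<close>, \<open>d\<^sub>h f = [f - h f]\<close>, where \<open>I = ker h\<close>.\<close>

definition Omega ::
  "('k,'m) ring_scheme \<Rightarrow> ('k,'a,'p) module_scheme \<Rightarrow> ('a \<Rightarrow> 'k) \<Rightarrow> ('k,'a set) module"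
  where "Omega K A h = (let I = a_kernel A K h in
    quot_mod (A\<lparr>carrier := I\<rparr>) (I \<cdot>\<^bsub>A\<^esub> I))"

definition univ_der ::
  "('k,'m) ring_scheme \<Rightarrow> ('k,'a,'p) module_scheme \<Rightarrow> ('a \<Rightarrow> 'k) \<Rightarrow> 'a \<Rightarrow> 'a set"
  where "univ_der K A h f = (let I = a_kernel A K h in
    (I \<cdot>\<^bsub>A\<^esub> I) +>\<^bsub>A\<^esub> (f \<ominus>\<^bsub>A\<^esub> (h f \<odot>\<^bsub>A\<^esub> \<one>\<^bsub>A\<^esub>)))"


section \<open>Symmetric powers of a module\<close>

definition free_mod :: "('k,'m) ring_scheme \<Rightarrow> 'x set \<Rightarrow> ('k,'x \<Rightarrow> 'k) module"
  where "free_mod K X = \<lparr>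
    carrier = {u. (\<forall>x. u x \<in> carrier K) \<and> finite {x. u x \<noteq> \<zero>\<^bsub>K\<^esub>} \<and> {x. u x \<noteq> \<zero>\<^bsub>K\<^esub>} \<subseteq> X},
    monoid.mult = undefined, one = undefined,
    zero = (\<lambda>x. \<zero>\<^bsub>K\<^esub>), add = (\<lambda>u v x. u x \<oplus>\<^bsub>K\<^esub> v x), smult = (\<lambda>c u x. c \<otimes>\<^bsub>K\<^esub> u x)\<rparr>"

definition free_gen :: "('k,'m) ring_scheme \<Rightarrow> 'x \<Rightarrow> 'x \<Rightarrow> 'k"
  where "free_gen K x = (\<lambda>y. if y = x then \<one>\<^bsub>K\<^esub> else \<zero>\<^bsub>K\<^esub>)"

definition submod_gen ::
  "('k,'m) ring_scheme \<Rightarrow> ('k,'a,'p) module_scheme \<Rightarrow> 'a set \<Rightarrow> 'a set"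
  where "submod_gen K M E = \<Inter>{N. submodule N K M \<and> E \<subseteq> N}"

text \<open>The \<open>n\<close>-th symmetric power of \<open>M\<close> is presented as the free module on the formal commutative
  products of \<open>n\<close> elements of \<open>M\<close> (multisets of size \<open>n\<close>), modulo the relations that make the
  product linear in each factor; indexing by multisets accounts for the symmetry relations.\<close>

definition sym_words :: "('k,'a,'p) module_scheme \<Rightarrow> nat \<Rightarrow> 'a multiset set"
  where "sym_words M n = {X. size X = n \<and> set_mset X \<subseteq> carrier M}"

definition sym_rels ::
  "('k,'m) ring_scheme \<Rightarrow> ('k,'a,'p) module_scheme \<Rightarrow> nat \<Rightarrow> ('a multiset \<Rightarrow> 'k) set"
  where "sym_rels K M n = (let F = free_mod K (sym_words M n); e = free_gen K in
    {e (add_mset (x \<oplus>\<^bsub>M\<^esub> y) X) \<ominus>\<^bsub>F\<^esub> (e (add_mset x X) \<oplus>\<^bsub>F\<^esub> e (add_mset y X)) | x y X.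
       x \<in> carrier M \<and> y \<in> carrier M \<and> set_mset X \<subseteq> carrier M \<and> Suc (size X) = n} \<union>
    {e (add_mset (c \<odot>\<^bsub>M\<^esub> x) X) \<ominus>\<^bsub>F\<^esub> (c \<odot>\<^bsub>F\<^esub> e (add_mset x X)) | c x X.
       c \<in> carrier K \<and> x \<in> carrier M \<and> set_mset X \<subseteq> carrier M \<and> Suc (size X) = n})"

definition sym_null ::
  "('k,'m) ring_scheme \<Rightarrow> ('k,'a,'p) module_scheme \<Rightarrow> nat \<Rightarrow> ('a multiset \<Rightarrow> 'k) set"
  where "sym_null K M n = submod_gen K (free_mod K (sym_words M n)) (sym_rels K M n)"

definition sym_pow ::
  "('k,'m) ring_scheme \<Rightarrow> ('k,'a,'p) module_scheme \<Rightarrow> nat \<Rightarrow> ('k,('a multiset \<Rightarrow> 'k) set) module"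
  where "sym_pow K M n = quot_mod (free_mod K (sym_words M n)) (sym_null K M n)"

text \<open>The product \<open>x\<^sub>1 \<odot> \<dots> \<odot> x\<^sub>n\<close> in the \<open>n\<close>-th symmetric power, \<open>n\<close> being the length of the list.\<close>

definition sym_prod ::
  "('k,'m) ring_scheme \<Rightarrow> ('k,'a,'p) module_scheme \<Rightarrow> 'a list \<Rightarrow> ('a multiset \<Rightarrow> 'k) set"
  where "sym_prod K M xs = (let n = length xs in
    sym_null K M n +>\<^bsub>free_mod K (sym_words M n)\<^esub> free_gen K (mset xs))"


section \<open>Principal symbol and ellipticity\<close>

definition dlt_at ::
  "('k,'m) ring_scheme \<Rightarrow> ('k,'a,'p) module_scheme \<Rightarrow> ('a \<Rightarrow> 'k) \<Rightarrow> 'a \<Rightarrow> ('a \<Rightarrow> 'k) \<Rightarrow> 'a \<Rightarrow> 'k"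
  where "dlt_at K A h f G = (\<lambda>p. G (f \<otimes>\<^bsub>A\<^esub> p) \<ominus>\<^bsub>K\<^esub> h f \<otimes>\<^bsub>K\<^esub> G p)"

text \<open>Extensionality singles out one representing function, so that the description is unique.\<close>

definition symbol ::
  "('k,'m) ring_scheme \<Rightarrow> ('k,'a,'p) module_scheme \<Rightarrow> nat \<Rightarrow> ('a \<Rightarrow> 'a) \<Rightarrow> ('a \<Rightarrow> 'k) \<Rightarrow>
    ('a set multiset \<Rightarrow> 'k) set \<Rightarrow> 'k"
  where "symbol K A k L h = (THE \<sigma>.
    \<sigma> \<in> lin_maps K (sym_pow K (Omega K A h) k) (ground K) \<and>
    \<sigma> \<in> extensional (carrier (sym_pow K (Omega K A h) k)) \<and>
    (\<forall>fs. length fs = k \<and> set fs \<subseteq> carrier A \<longrightarrow>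
      \<sigma> (sym_prod K (Omega K A h) (map (univ_der K A h) fs)) =
        foldr (dlt_at K A h) fs (h \<circ> L) \<one>\<^bsub>A\<^esub>))"

definition of_order_at ::
  "('k,'m) ring_scheme \<Rightarrow> ('k,'a,'p) module_scheme \<Rightarrow> nat \<Rightarrow> ('a \<Rightarrow> 'a) \<Rightarrow> ('a \<Rightarrow> 'k) \<Rightarrow> bool"
  where "of_order_at K A k L h \<longleftrightarrow>
    (\<exists>w\<in>carrier (sym_pow K (Omega K A h) k). symbol K A k L h w \<noteq> \<zero>\<^bsub>K\<^esub>)"

definition elliptic_at ::
  "('k,'m) ring_scheme \<Rightarrow> ('k,'a,'p) module_scheme \<Rightarrow> nat \<Rightarrow> ('a \<Rightarrow> 'a) \<Rightarrow> ('a \<Rightarrow> 'k) \<Rightarrow> bool"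
  where "elliptic_at K A k L h \<longleftrightarrow> of_order_at K A k L h \<and>
    (\<forall>\<alpha>\<in>carrier (Omega K A h). \<alpha> \<noteq> \<zero>\<^bsub>Omega K A h\<^esub> \<longrightarrow>
      inj_on (\<lambda>c. c \<otimes>\<^bsub>K\<^esub> symbol K A k L h (sym_prod K (Omega K A h) (replicate k \<alpha>))) (carrier K))"

definition elliptic_ldo ::
  "('k,'m) ring_scheme \<Rightarrow> ('k,'a,'p) module_scheme \<Rightarrow> nat \<Rightarrow> ('a \<Rightarrow> 'a) \<Rightarrow> bool"
  where "elliptic_ldo K A k L \<longleftrightarrow>
    ldo_of_order K A k L \<and> (\<forall>h\<in>points K A. elliptic_at K A k L h)"

end

theory Submission
  imports Defs "HOL-Algebra.RingHom"
begin

text \<open>The symbol of an operator \<open>L\<close> of order \<open>\<le> k\<close> at a point \<open>h\<close> exists because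
  \<open>h (\<delta>(f\<^sub>1) \<dots> \<delta>(f\<^sub>k) L 1)\<close> is symmetric in the \<open>f\<^sub>i\<close> and, all further commutators being zero, an
  \<open>h\<close>-derivation in each of them, hence a function of the classes \<open>d\<^sub>h f\<^sub>i\<close>; it is unique because the
  products of such classes generate the symmetric power. Intertwined operators satisfy
  \<open>\<pi> \<circ> \<delta>(f\<^sub>1) \<dots> \<delta>(f\<^sub>k) L = \<delta>(\<pi> f\<^sub>1) \<dots> \<delta>(\<pi> f\<^sub>k) L' \<circ> \<pi>\<close>, so the symbols of \<open>L\<close> at \<open>h \<circ> \<pi>\<close> and of
  \<open>L'\<close> at \<open>h\<close> take the same values on corresponding products. Every covector at \<open>h\<close> has the form
  \<open>d\<^sub>h (\<pi> f)\<close>, and \<open>d\<^sub>h\<^sub>\<circ>\<^sub>\<pi> f\<close> is non-zero whenever \<open>d\<^sub>h (\<pi> f)\<close> is, because \<open>\<pi>\<close> maps the square of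
  \<open>ker (h \<circ> \<pi>)\<close> into that of \<open>ker h\<close>. Ellipticity thus descends, and non-vanishing of the symbol
  at a single point excludes order \<open>< k\<close>.\<close>

section \<open>Linear maps, and the ring K as a module over itself\<close>

lemma lin_mapsI:
  assumes "\<And>x. x \<in> carrier M \<Longrightarrow> F x \<in> carrier N"
    and "\<And>x y. x \<in> carrier M \<Longrightarrow> y \<in> carrier M \<Longrightarrow> F (x \<oplus>\<^bsub>M\<^esub> y) = F x \<oplus>\<^bsub>N\<^esub> F y"
    and "\<And>c x. c \<in> carrier K \<Longrightarrow> x \<in> carrier M \<Longrightarrow> F (c \<odot>\<^bsub>M\<^esub> x) = c \<odot>\<^bsub>N\<^esub> F x"
  shows "F \<in> lin_maps K M N"
  using assms unfolding lin_maps_def by auto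

lemma lin_mapsD:
  assumes "F \<in> lin_maps K M N"
  shows "x \<in> carrier M \<Longrightarrow> F x \<in> carrier N"
    and "x \<in> carrier M \<Longrightarrow> y \<in> carrier M \<Longrightarrow> F (x \<oplus>\<^bsub>M\<^esub> y) = F x \<oplus>\<^bsub>N\<^esub> F y"
    and "c \<in> carrier K \<Longrightarrow> x \<in> carrier M \<Longrightarrow> F (c \<odot>\<^bsub>M\<^esub> x) = c \<odot>\<^bsub>N\<^esub> F x"
  using assms unfolding lin_maps_def by auto

lemma ground_simps [simp]:
  "carrier (ground K) = carrier K" "\<zero>\<^bsub>ground K\<^esub> = \<zero>\<^bsub>K\<^esub>" "\<one>\<^bsub>ground K\<^esub> = \<one>\<^bsub>K\<^esub>"
  "x \<oplus>\<^bsub>ground K\<^esub> y = x \<oplus>\<^bsub>K\<^esub> y" "x \<otimes>\<^bsub>ground K\<^esub> y = x \<otimes>\<^bsub>K\<^esub> y" "x \<odot>\<^bsub>ground K\<^esub> y = x \<otimes>\<^bsub>K\<^esub> y"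
  by (simp_all add: ground_def)

lemma list_imageE:
  assumes "set ys \<subseteq> f ` A"
  obtains xs where "set xs \<subseteq> A" "ys = map f xs"
proof -
  have "ys \<in> map f ` lists A" using assms unfolding lists_image[symmetric] by blast
  then show ?thesis using that by blast
qed

section \<open>Quotient modules\<close>

lemma quot_mod_simps:
  "carrier (quot_mod M N) = (\<lambda>x. N +>\<^bsub>M\<^esub> x) ` carrier M"
  "\<zero>\<^bsub>quot_mod M N\<^esub> = N" "X \<oplus>\<^bsub>quot_mod M N\<^esub> Y = set_add M X Y"
  "c \<odot>\<^bsub>quot_mod M N\<^esub> X = (\<Union>x\<in>X. N +>\<^bsub>M\<^esub> (c \<odot>\<^bsub>M\<^esub> x))"
  by (auto simp: quot_mod_def A_RCOSETS_defs a_r_coset_defs)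

text \<open>Instantiated twice: for I / I^2, where M is A with its carrier cut down to I, and for
  the free module on words modulo the relations of a symmetric power.\<close>

locale quotient_module = module K M for K (structure) and M (structure) +
  fixes N
  assumes sub: "submodule N K M"
begin

sublocale N: abelian_subgroup N M
proof (rule abelian_subgroupI3)
  show "additive_subgroup N M"
    using sub by (simp add: additive_subgroup.intro submodule_def)
qed (rule M.abelian_group_axioms)

lemma coset_add:
  "x \<in> carrier M \<Longrightarrow> y \<in> carrier M \<Longrightarrow>
    (N +>\<^bsub>M\<^esub> x) \<oplus>\<^bsub>quot_mod M N\<^esub> (N +>\<^bsub>M\<^esub> y) = N +>\<^bsub>M\<^esub> (x \<oplus>\<^bsub>M\<^esub> y)"
  by (simp add: quot_mod_simps N.a_rcos_sum)

lemma coset_eq_iff: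
  assumes "x \<in> carrier M" "y \<in> carrier M"
  shows "N +>\<^bsub>M\<^esub> x = N +>\<^bsub>M\<^esub> y \<longleftrightarrow> x \<ominus>\<^bsub>M\<^esub> y \<in> N"
proof -
  have "x \<ominus>\<^bsub>M\<^esub> y \<in> N \<longleftrightarrow> x \<in> N +>\<^bsub>M\<^esub> y"
    unfolding a_minus_def by (rule N.a_rcos_module[OF assms(2,1), symmetric])
  moreover have "N +>\<^bsub>M\<^esub> x = N +>\<^bsub>M\<^esub> y" if "x \<in> N +>\<^bsub>M\<^esub> y"
    by (rule N.a_repr_independence'[OF that assms(2), symmetric])
  moreover have "x \<in> N +>\<^bsub>M\<^esub> y" if "N +>\<^bsub>M\<^esub> x = N +>\<^bsub>M\<^esub> y"
    using N.a_rcos_self[OF assms(1)] unfolding that .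
  ultimately show ?thesis by metis
qed

text \<open>\<open>quot_mod\<close> scales a coset by taking the union of the cosets of all scaled
  representatives. Closure of N under scalars makes these cosets coincide, so the union collapses to
  one of them.\<close>

lemma coset_smult:
  assumes c: "c \<in> carrier K" and x: "x \<in> carrier M"
  shows "c \<odot>\<^bsub>quot_mod M N\<^esub> (N +>\<^bsub>M\<^esub> x) = N +>\<^bsub>M\<^esub> (c \<odot>\<^bsub>M\<^esub> x)"
proof -
  have "N +>\<^bsub>M\<^esub> (c \<odot>\<^bsub>M\<^esub> y) = N +>\<^bsub>M\<^esub> (c \<odot>\<^bsub>M\<^esub> x)" if y: "y \<in> N +>\<^bsub>M\<^esub> x" for y
  proof -
    have yM: "y \<in> carrier M" by (rule N.a_elemrcos_carrier[OF x y])
    have "y \<ominus>\<^bsub>M\<^esub> x \<in> N" using N.a_rcos_module_imp[OF x y] by (simp add: a_minus_def)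
    then have "c \<odot>\<^bsub>M\<^esub> (y \<ominus>\<^bsub>M\<^esub> x) \<in> N" by (rule submodule.smult_closed[OF sub c])
    then have "c \<odot>\<^bsub>M\<^esub> y \<ominus>\<^bsub>M\<^esub> c \<odot>\<^bsub>M\<^esub> x \<in> N"
      using c x yM by (simp add: M.minus_eq smult_r_distr smult_r_minus)
    then show ?thesis using c x yM by (simp add: coset_eq_iff)
  qed
  moreover have "x \<in> N +>\<^bsub>M\<^esub> x" using x by (rule N.a_rcos_self)
  ultimately show ?thesis unfolding quot_mod_simps by blast
qed

lemma mem_quot_mod: "X \<in> carrier (quot_mod M N) \<longleftrightarrow> (\<exists>x\<in>carrier M. X = N +>\<^bsub>M\<^esub> x)"
  unfolding quot_mod_simps by blast

lemma coset_closed [simp]: "x \<in> carrier M \<Longrightarrow> N +>\<^bsub>M\<^esub> x \<in> carrier (quot_mod M N)"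
  unfolding mem_quot_mod by blast

lemma coset_zero_iff: "x \<in> carrier M \<Longrightarrow> N +>\<^bsub>M\<^esub> x = N \<longleftrightarrow> x \<in> N"
  using N.a_rcos_self[of x] N.a_rcos_const[of x] by auto

lemma zero_eq_coset: "\<zero>\<^bsub>quot_mod M N\<^esub> = N +>\<^bsub>M\<^esub> \<zero>\<^bsub>M\<^esub>"
  unfolding quot_mod_simps using coset_zero_iff[of "\<zero>\<^bsub>M\<^esub>"] N.zero_closed by simp

lemma module_quot_mod: "module K (quot_mod M N)"
proof (rule moduleI[OF R.is_cring], rule abelian_groupI)
  fix X Y assume "X \<in> carrier (quot_mod M N)" "Y \<in> carrier (quot_mod M N)"
  then obtain x y where xy: "x \<in> carrier M" "y \<in> carrier M" "X = N +>\<^bsub>M\<^esub> x" "Y = N +>\<^bsub>M\<^esub> y"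
    unfolding mem_quot_mod by blast
  show "X \<oplus>\<^bsub>quot_mod M N\<^esub> Y \<in> carrier (quot_mod M N)"
    using xy by (simp add: coset_add)
  show "X \<oplus>\<^bsub>quot_mod M N\<^esub> Y = Y \<oplus>\<^bsub>quot_mod M N\<^esub> X"
    using xy M.a_comm[of x y] by (simp add: coset_add)
  show "c \<odot>\<^bsub>quot_mod M N\<^esub> (X \<oplus>\<^bsub>quot_mod M N\<^esub> Y)
      = c \<odot>\<^bsub>quot_mod M N\<^esub> X \<oplus>\<^bsub>quot_mod M N\<^esub> c \<odot>\<^bsub>quot_mod M N\<^esub> Y" if "c \<in> carrier K" for c
    using xy that by (simp add: coset_add coset_smult smult_r_distr)
  show "X \<oplus>\<^bsub>quot_mod M N\<^esub> Y \<oplus>\<^bsub>quot_mod M N\<^esub> Z = X \<oplus>\<^bsub>quot_mod M N\<^esub> (Y \<oplus>\<^bsub>quot_mod M N\<^esub> Z)"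
    if "Z \<in> carrier (quot_mod M N)" for Z
  proof -
    obtain z where "z \<in> carrier M" "Z = N +>\<^bsub>M\<^esub> z" using \<open>Z \<in> _\<close> unfolding mem_quot_mod by blast
    then show ?thesis using xy by (simp add: coset_add M.a_assoc)
  qed
next
  show "\<zero>\<^bsub>quot_mod M N\<^esub> \<in> carrier (quot_mod M N)" by (simp add: zero_eq_coset)
next
  fix X assume "X \<in> carrier (quot_mod M N)"
  then obtain x where x: "x \<in> carrier M" "X = N +>\<^bsub>M\<^esub> x"
    unfolding mem_quot_mod by blast
  show "\<zero>\<^bsub>quot_mod M N\<^esub> \<oplus>\<^bsub>quot_mod M N\<^esub> X = X"
    using x by (simp add: zero_eq_coset coset_add)
  have "(N +>\<^bsub>M\<^esub> (\<ominus>\<^bsub>M\<^esub> x)) \<oplus>\<^bsub>quot_mod M N\<^esub> X = \<zero>\<^bsub>quot_mod M N\<^esub>"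
    using x by (simp add: zero_eq_coset coset_add M.l_neg)
  then show "\<exists>Y\<in>carrier (quot_mod M N). Y \<oplus>\<^bsub>quot_mod M N\<^esub> X = \<zero>\<^bsub>quot_mod M N\<^esub>"
    using x by (intro bexI[of _ "N +>\<^bsub>M\<^esub> (\<ominus>\<^bsub>M\<^esub> x)"]) simp_all
  show "c \<odot>\<^bsub>quot_mod M N\<^esub> X \<in> carrier (quot_mod M N)" if "c \<in> carrier K" for c
    using x that by (simp add: coset_smult)
  show "\<one> \<odot>\<^bsub>quot_mod M N\<^esub> X = X"
    using x by (simp add: coset_smult)
  show "(c \<oplus> e) \<odot>\<^bsub>quot_mod M N\<^esub> X = c \<odot>\<^bsub>quot_mod M N\<^esub> X \<oplus>\<^bsub>quot_mod M N\<^esub> e \<odot>\<^bsub>quot_mod M N\<^esub> X"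
    and "(c \<otimes> e) \<odot>\<^bsub>quot_mod M N\<^esub> X = c \<odot>\<^bsub>quot_mod M N\<^esub> (e \<odot>\<^bsub>quot_mod M N\<^esub> X)"
    if "c \<in> carrier K" "e \<in> carrier K" for c e
    using x that by (simp_all add: coset_smult coset_add smult_l_distr smult_assoc1)
qed

lemma functional_factors:
  assumes F: "F \<in> lin_maps K M (ground K)" and null: "\<And>x. x \<in> N \<Longrightarrow> F x = \<zero>"
  obtains \<sigma> where "\<sigma> \<in> lin_maps K (quot_mod M N) (ground K)"
    and "\<And>x. x \<in> carrier M \<Longrightarrow> \<sigma> (N +>\<^bsub>M\<^esub> x) = F x"
proof -
  \<comment> \<open>Any representative gives the same value: two of them differ by an element of N,
    where F vanishes.\<close>
  define \<sigma> where "\<sigma> X = F (SOME x. x \<in> carrier M \<and> X = N +>\<^bsub>M\<^esub> x)" for X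
  have \<sigma>: "\<sigma> (N +>\<^bsub>M\<^esub> x) = F x" if x: "x \<in> carrier M" for x
  proof -
    define y where "y = (SOME y. y \<in> carrier M \<and> N +>\<^bsub>M\<^esub> x = N +>\<^bsub>M\<^esub> y)"
    have y: "y \<in> carrier M" "N +>\<^bsub>M\<^esub> x = N +>\<^bsub>M\<^esub> y"
      using someI[of "\<lambda>y. y \<in> carrier M \<and> N +>\<^bsub>M\<^esub> x = N +>\<^bsub>M\<^esub> y" x] x by (simp_all add: y_def)
    have "x \<ominus>\<^bsub>M\<^esub> y \<in> N" using y coset_eq_iff[OF x y(1)] by simp
    then have "F (x \<ominus>\<^bsub>M\<^esub> y) = \<zero>" by (rule null)
    moreover have "x = (x \<ominus>\<^bsub>M\<^esub> y) \<oplus>\<^bsub>M\<^esub> y"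
      using x y(1) by (simp add: M.minus_eq M.a_assoc M.l_neg)
    then have "F x = F (x \<ominus>\<^bsub>M\<^esub> y) \<oplus> F y"
      using lin_mapsD(2)[OF F, of "x \<ominus>\<^bsub>M\<^esub> y" y] x y(1) by simp
    ultimately have "F x = F y" using lin_mapsD(1)[OF F y(1)] by simp
    then show ?thesis by (simp add: \<sigma>_def y_def)
  qed
  have "\<sigma> \<in> lin_maps K (quot_mod M N) (ground K)"
  proof (rule lin_mapsI)
    fix X Y assume "X \<in> carrier (quot_mod M N)" "Y \<in> carrier (quot_mod M N)"
    then obtain x y where xy: "x \<in> carrier M" "y \<in> carrier M" "X = N +>\<^bsub>M\<^esub> x" "Y = N +>\<^bsub>M\<^esub> y"
      unfolding mem_quot_mod by blast
    show "\<sigma> X \<in> carrier (ground K)"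
      using xy lin_mapsD(1)[OF F] by (simp add: \<sigma>)
    show "\<sigma> (X \<oplus>\<^bsub>quot_mod M N\<^esub> Y) = \<sigma> X \<oplus>\<^bsub>ground K\<^esub> \<sigma> Y"
      using xy lin_mapsD(2)[OF F] by (simp add: \<sigma> coset_add)
    show "\<sigma> (c \<odot>\<^bsub>quot_mod M N\<^esub> X) = c \<odot>\<^bsub>ground K\<^esub> \<sigma> X" if "c \<in> carrier K" for c
      using xy that lin_mapsD(3)[OF F] by (simp add: \<sigma> coset_smult)
  qed
  with \<sigma> show ?thesis by (rule that[rotated])
qed

end

section \<open>Free modules and symmetric powers\<close>

lemma free_mod_simps:
  "\<zero>\<^bsub>free_mod K X\<^esub> = (\<lambda>x. \<zero>\<^bsub>K\<^esub>)"
  "u \<oplus>\<^bsub>free_mod K X\<^esub> v = (\<lambda>x. u x \<oplus>\<^bsub>K\<^esub> v x)"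
  "c \<odot>\<^bsub>free_mod K X\<^esub> u = (\<lambda>x. c \<otimes>\<^bsub>K\<^esub> u x)"
  by (simp_all add: free_mod_def)

text \<open>Trading the exact support for any finite set containing it avoids cancellation: a sum is
  carried by the union of two such sets, although its support may be smaller.\<close>

lemma mem_free_mod:
  "u \<in> carrier (free_mod K X) \<longleftrightarrow> (\<forall>x. u x \<in> carrier K) \<and>
    (\<exists>B. finite B \<and> B \<subseteq> X \<and> (\<forall>x. x \<notin> B \<longrightarrow> u x = \<zero>\<^bsub>K\<^esub>))"
proof
  assume "u \<in> carrier (free_mod K X)"
  then show "(\<forall>x. u x \<in> carrier K) \<and> (\<exists>B. finite B \<and> B \<subseteq> X \<and> (\<forall>x. x \<notin> B \<longrightarrow> u x = \<zero>\<^bsub>K\<^esub>))"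
    unfolding free_mod_def by (auto intro!: exI[of _ "{x. u x \<noteq> \<zero>\<^bsub>K\<^esub>}"])
next
  assume "(\<forall>x. u x \<in> carrier K) \<and> (\<exists>B. finite B \<and> B \<subseteq> X \<and> (\<forall>x. x \<notin> B \<longrightarrow> u x = \<zero>\<^bsub>K\<^esub>))"
  then obtain B where "\<forall>x. u x \<in> carrier K" "finite B" "B \<subseteq> X" "{x. u x \<noteq> \<zero>\<^bsub>K\<^esub>} \<subseteq> B" by blast
  then show "u \<in> carrier (free_mod K X)"
    unfolding free_mod_def using finite_subset by fastforce
qed

context cring
begin

lemma free_mod_closed:
  assumes u: "u \<in> carrier (free_mod R X)"
  shows "v \<in> carrier (free_mod R X) \<Longrightarrow> (\<lambda>x. u x \<oplus> v x) \<in> carrier (free_mod R X)"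
    and "c \<in> carrier R \<Longrightarrow> (\<lambda>x. c \<otimes> u x) \<in> carrier (free_mod R X)"
    and "(\<lambda>x. \<ominus> u x) \<in> carrier (free_mod R X)"
proof -
  obtain B where B: "finite B" "B \<subseteq> X" "\<forall>x. x \<notin> B \<longrightarrow> u x = \<zero>" "\<forall>x. u x \<in> carrier R"
    using u unfolding mem_free_mod by blast
  show "(\<lambda>x. u x \<oplus> v x) \<in> carrier (free_mod R X)" if v: "v \<in> carrier (free_mod R X)"
  proof -
    obtain C where "finite C" "C \<subseteq> X" "\<forall>x. x \<notin> C \<longrightarrow> v x = \<zero>" "\<forall>x. v x \<in> carrier R"
      using v unfolding mem_free_mod by blast
    then show ?thesis
      unfolding mem_free_mod using B by (intro conjI exI[of _ "B \<union> C"]) simp_all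
  qed
  show "(\<lambda>x. c \<otimes> u x) \<in> carrier (free_mod R X)" if "c \<in> carrier R"
    unfolding mem_free_mod using B that by (intro conjI exI[of _ B]) simp_all
  show "(\<lambda>x. \<ominus> u x) \<in> carrier (free_mod R X)"
    unfolding mem_free_mod using B by (intro conjI exI[of _ B]) simp_all
qed

lemma free_mod_coeff: "u \<in> carrier (free_mod R X) \<Longrightarrow> u x \<in> carrier R"
  unfolding mem_free_mod by blast

lemma module_free_mod: "module R (free_mod R X)"
proof (rule moduleI[OF is_cring], rule abelian_groupI)
  show "\<zero>\<^bsub>free_mod R X\<^esub> \<in> carrier (free_mod R X)"
    unfolding mem_free_mod free_mod_simps by (intro conjI exI[of _ "{}"]) simp_all
next
  fix u assume u: "u \<in> carrier (free_mod R X)"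
  then have uc: "u x \<in> carrier R" for x unfolding mem_free_mod by blast
  show "\<exists>v\<in>carrier (free_mod R X). v \<oplus>\<^bsub>free_mod R X\<^esub> u = \<zero>\<^bsub>free_mod R X\<^esub>"
    using free_mod_closed(3)[OF u] uc
    by (intro bexI[of _ "\<lambda>x. \<ominus> u x"]) (simp_all add: free_mod_simps l_neg)
qed (simp_all add: free_mod_simps free_mod_closed free_mod_coeff a_assoc a_comm a_lcomm
      l_distr r_distr m_assoc)

lemma free_gen_closed [simp]: "x \<in> X \<Longrightarrow> free_gen R x \<in> carrier (free_mod R X)"
  unfolding mem_free_mod free_gen_def by (intro conjI exI[of _ "{x}"]) simp_all

text \<open>Induction on a finite set carrying \<open>u\<close>: clearing one coordinate leaves a
  function carried by a smaller set, and what was cleared is a multiple of a generator.\<close>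

lemma free_mod_generated:
  assumes N: "submodule N R (free_mod R X)" and gen: "\<And>x. x \<in> X \<Longrightarrow> free_gen R x \<in> N"
    and u: "u \<in> carrier (free_mod R X)"
  shows "u \<in> N"
proof -
  interpret F: module R "free_mod R X" by (rule module_free_mod)
  interpret N: submodule N R "free_mod R X" by fact
  obtain B where "finite B" "B \<subseteq> X" "\<forall>x. x \<notin> B \<longrightarrow> u x = \<zero>" "\<forall>x. u x \<in> carrier R"
    using u unfolding mem_free_mod by blast
  then show ?thesis
  proof (induction B arbitrary: u rule: finite_induct)
    case empty
    then have "u = \<zero>\<^bsub>free_mod R X\<^esub>" by (simp add: free_mod_simps fun_eq_iff)
    then show ?case using N.one_closed by simp
  next
    case (insert b B)
    have "u(b := \<zero>) \<in> N"
      using insert.prems by (intro insert.IH) simp_all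
    moreover have "u b \<odot>\<^bsub>free_mod R X\<^esub> free_gen R b \<in> N"
      using insert.prems by (intro N.smult_closed gen) simp_all
    moreover have "u(b := \<zero>) \<oplus>\<^bsub>free_mod R X\<^esub> (u b \<odot>\<^bsub>free_mod R X\<^esub> free_gen R b) = u"
      using insert.prems by (simp add: free_mod_simps free_gen_def fun_eq_iff)
    ultimately show ?case using N.m_closed by fastforce
  qed
qed

lemma free_mod_extend:
  assumes \<psi>: "\<And>x. x \<in> X \<Longrightarrow> \<psi> x \<in> carrier R"
  obtains F where "F \<in> lin_maps R (free_mod R X) (ground R)"
    and "\<And>x. x \<in> X \<Longrightarrow> F (free_gen R x) = \<psi> x"
proof -
  define F where "F u = (\<Oplus>x\<in>{x. u x \<noteq> \<zero>}. u x \<otimes> \<psi> x)" for u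
  \<comment> \<open>The sum over the support may be taken over any finite set carrying
    \<open>u\<close>; additivity of \<open>F\<close> is then read off over a common set for both
    summands.\<close>
  have F: "F u = (\<Oplus>x\<in>B. u x \<otimes> \<psi> x)"
    if "finite B" "B \<subseteq> X" "\<forall>x. x \<notin> B \<longrightarrow> u x = \<zero>" "\<forall>x. u x \<in> carrier R" for u B
    unfolding F_def using that \<psi> by (intro add.finprod_mono_neutral_cong_left) (auto simp: subset_iff)
  have "F \<in> lin_maps R (free_mod R X) (ground R)"
  proof (rule lin_mapsI)
    fix u v assume u: "u \<in> carrier (free_mod R X)" and v: "v \<in> carrier (free_mod R X)"
    obtain B C where BC: "finite B" "B \<subseteq> X" "\<forall>x. x \<notin> B \<longrightarrow> u x = \<zero>"
      "finite C" "C \<subseteq> X" "\<forall>x. x \<notin> C \<longrightarrow> v x = \<zero>"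
      and c: "\<forall>x. u x \<in> carrier R" "\<forall>x. v x \<in> carrier R"
      using u v unfolding mem_free_mod by blast
    have p: "(\<lambda>x. u x \<otimes> \<psi> x) \<in> D \<rightarrow> carrier R" "(\<lambda>x. v x \<otimes> \<psi> x) \<in> D \<rightarrow> carrier R"
      if "D \<subseteq> X" for D
      using c \<psi> that by (simp_all add: Pi_iff subset_iff)
    have \<psi>': "\<psi> x \<in> carrier R" if "x \<in> B \<union> C" for x
      using that BC(2,5) by (intro \<psi>) blast
    show "F u \<in> carrier (ground R)"
      using F[of B u] BC c p(1)[of B] by (simp add: finsum_closed)
    have "F (u \<oplus>\<^bsub>free_mod R X\<^esub> v) = (\<Oplus>x\<in>B \<union> C. (u x \<oplus> v x) \<otimes> \<psi> x)"
      unfolding free_mod_simps using BC c by (intro F) simp_all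
    also have "\<dots> = (\<Oplus>x\<in>B \<union> C. u x \<otimes> \<psi> x \<oplus> v x \<otimes> \<psi> x)"
      using c \<psi>' by (intro finsum_cong' refl) (simp_all add: Pi_iff l_distr)
    also have "\<dots> = (\<Oplus>x\<in>B \<union> C. u x \<otimes> \<psi> x) \<oplus> (\<Oplus>x\<in>B \<union> C. v x \<otimes> \<psi> x)"
      using BC p[of "B \<union> C"] by (intro finsum_addf) simp_all
    also have "\<dots> = F u \<oplus> F v"
      using F[of "B \<union> C" u] F[of "B \<union> C" v] BC c by simp
    finally show "F (u \<oplus>\<^bsub>free_mod R X\<^esub> v) = F u \<oplus>\<^bsub>ground R\<^esub> F v" by simp
    fix a assume a: "a \<in> carrier R"
    have "F (a \<odot>\<^bsub>free_mod R X\<^esub> u) = (\<Oplus>x\<in>B. (a \<otimes> u x) \<otimes> \<psi> x)"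
      unfolding free_mod_simps using BC c a by (intro F) simp_all
    also have "\<dots> = (\<Oplus>x\<in>B. a \<otimes> (u x \<otimes> \<psi> x))"
      using c \<psi>' a by (intro finsum_cong' refl) (simp_all add: Pi_iff m_assoc)
    also have "\<dots> = a \<otimes> (\<Oplus>x\<in>B. u x \<otimes> \<psi> x)"
      using BC p(1)[of B] a by (simp add: finsum_rdistr)
    also have "\<dots> = a \<otimes> F u" using F[of B u] BC c by simp
    finally show "F (a \<odot>\<^bsub>free_mod R X\<^esub> u) = a \<odot>\<^bsub>ground R\<^esub> F u" by simp
  qed
  moreover have "F (free_gen R x) = \<psi> x" if x: "x \<in> X" for x
  proof -
    have "F (free_gen R x) = (\<Oplus>y\<in>{x}. free_gen R x y \<otimes> \<psi> y)"
      using x by (intro F) (simp_all add: free_gen_def)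
    also have "\<dots> = \<psi> x" using \<psi>[OF x] by (simp add: free_gen_def)
    finally show ?thesis .
  qed
  ultimately show ?thesis by (rule that)
qed

end

section \<open>Functionals on a module and generated submodules\<close>

context module
begin

lemma functional_zero: "F \<in> lin_maps R M (ground R) \<Longrightarrow> F \<zero>\<^bsub>M\<^esub> = \<zero>"
  using lin_mapsD(3)[of F R M "ground R" \<zero> "\<zero>\<^bsub>M\<^esub>"] lin_mapsD(1)[of F R M "ground R" "\<zero>\<^bsub>M\<^esub>"] by simp

lemma functional_minus:
  assumes F: "F \<in> lin_maps R M (ground R)" and x: "x \<in> carrier M" and y: "y \<in> carrier M"
  shows "F (x \<ominus>\<^bsub>M\<^esub> y) = F x \<ominus> F y"
proof -
  have "F (x \<ominus>\<^bsub>M\<^esub> y) \<oplus> F y = F (x \<ominus>\<^bsub>M\<^esub> y \<oplus>\<^bsub>M\<^esub> y)"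
    using lin_mapsD(2)[OF F, of "x \<ominus>\<^bsub>M\<^esub> y" y] x y by simp
  also have "x \<ominus>\<^bsub>M\<^esub> y \<oplus>\<^bsub>M\<^esub> y = x"
    using x y by (simp add: M.minus_eq M.a_assoc M.l_neg)
  finally have "F x = F (x \<ominus>\<^bsub>M\<^esub> y) \<oplus> F y" by simp
  then show ?thesis
    using lin_mapsD(1)[OF F, of "x \<ominus>\<^bsub>M\<^esub> y"] lin_mapsD(1)[OF F y] x y
    by (simp add: R.minus_eq R.a_assoc R.r_neg)
qed

text \<open>Functionals that agree on generators agree everywhere by this lemma; with the zero
  functional as \<open>G\<close> it turns kernels into submodules.\<close>

lemma equalizer_submodule:
  assumes F: "F \<in> lin_maps R M (ground R)" and G: "G \<in> lin_maps R M (ground R)"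
  shows "submodule {x \<in> carrier M. F x = G x} R M"
proof (rule submoduleI)
  show "\<zero>\<^bsub>M\<^esub> \<in> {x \<in> carrier M. F x = G x}"
    using functional_zero[OF F] functional_zero[OF G] by simp
  fix a assume a: "a \<in> {x \<in> carrier M. F x = G x}"
  have "\<ominus>\<^bsub>M\<^esub> a = \<zero>\<^bsub>M\<^esub> \<ominus>\<^bsub>M\<^esub> a" using a by (simp add: M.minus_eq)
  then have "F (\<ominus>\<^bsub>M\<^esub> a) = G (\<ominus>\<^bsub>M\<^esub> a)"
    using functional_minus[OF F M.zero_closed, of a] functional_minus[OF G M.zero_closed, of a]
      functional_zero[OF F] functional_zero[OF G] a by simp
  then show "\<ominus>\<^bsub>M\<^esub> a \<in> {x \<in> carrier M. F x = G x}" using a by simp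
qed (use lin_mapsD(2,3)[OF F] lin_mapsD(2,3)[OF G] in \<open>simp_all\<close>)

lemma zero_functional: "(\<lambda>x. \<zero>) \<in> lin_maps R M (ground R)"
  by (rule lin_mapsI) simp_all

lemma submod_gen_submodule:
  assumes "E \<subseteq> carrier M"
  shows "submodule (submod_gen R M E) R M"
proof (rule submoduleI)
  have "submodule (carrier M) R M" by (rule carrier_is_submodule)
  then show "submod_gen R M E \<subseteq> carrier M"
    unfolding submod_gen_def using assms by blast
  show "\<zero>\<^bsub>M\<^esub> \<in> submod_gen R M E"
    unfolding submod_gen_def using subgroup.one_closed[of _ "add_monoid M"]
    by (simp add: submodule_def)
qed (use submoduleE(3-5) in \<open>simp_all add: submod_gen_def\<close>)

lemma submod_gen_least: "submodule N R M \<Longrightarrow> E \<subseteq> N \<Longrightarrow> submod_gen R M E \<subseteq> N"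
  unfolding submod_gen_def by blast

section \<open>The presentation of the symmetric powers\<close>

abbreviation "words n \<equiv> free_mod R (sym_words M n)"

lemma mem_sym_words: "X \<in> sym_words M n \<longleftrightarrow> size X = n \<and> set_mset X \<subseteq> carrier M"
  by (simp add: sym_words_def)

lemma add_mset_word:
  "x \<in> carrier M \<Longrightarrow> set_mset X \<subseteq> carrier M \<Longrightarrow> Suc (size X) = n \<Longrightarrow> add_mset x X \<in> sym_words M n"
  by (simp add: mem_sym_words)

lemma sym_relsE:
  assumes "u \<in> sym_rels R M n"
  obtains (add) x y X where "x \<in> carrier M" "y \<in> carrier M" "set_mset X \<subseteq> carrier M" "Suc (size X) = n"
    "u = free_gen R (add_mset (x \<oplus>\<^bsub>M\<^esub> y) X) \<ominus>\<^bsub>words n\<^esub>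
      (free_gen R (add_mset x X) \<oplus>\<^bsub>words n\<^esub> free_gen R (add_mset y X))"
  | (smult) c x X where "c \<in> carrier R" "x \<in> carrier M" "set_mset X \<subseteq> carrier M" "Suc (size X) = n"
    "u = free_gen R (add_mset (c \<odot>\<^bsub>M\<^esub> x) X) \<ominus>\<^bsub>words n\<^esub> (c \<odot>\<^bsub>words n\<^esub> free_gen R (add_mset x X))"
  using assms unfolding sym_rels_def Let_def by blast

lemma sym_rels_closed: "sym_rels R M n \<subseteq> carrier (words n)"
proof
  interpret F: module R "words n" by (rule R.module_free_mod)
  fix u assume "u \<in> sym_rels R M n"
  then show "u \<in> carrier (words n)"
  proof (cases rule: sym_relsE)
    case (add x y X)
    show ?thesis unfolding add(5) using add(1-4)
      by (intro F.minus_closed F.a_closed R.free_gen_closed add_mset_word M.a_closed)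
  next
    case (smult c x X)
    show ?thesis unfolding smult(5) using smult(1-4)
      by (intro F.minus_closed F.smult_closed R.free_gen_closed add_mset_word smult_closed)
  qed
qed

end

section \<open>The universal property of the symmetric powers\<close>

context module
begin

interpretation sym: quotient_module R "words n" "sym_null R M n" for n
  unfolding sym_null_def
  by (intro quotient_module.intro quotient_module_axioms.intro R.module_free_mod
      module.submod_gen_submodule sym_rels_closed)

lemma module_sym_pow: "module R (sym_pow R M n)"
  unfolding sym_pow_def by (rule sym.module_quot_mod)

lemma sym_prod_closed:
  "set xs \<subseteq> carrier M \<Longrightarrow> sym_prod R M xs \<in> carrier (sym_pow R M (length xs))"
  unfolding sym_pow_def sym_prod_def Let_def
  by (intro sym.coset_closed R.free_gen_closed) (simp add: mem_sym_words)

text \<open>Both functionals are pulled back to the free module on words. The equalizer of the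
  pullbacks contains every generator, since each multiset is the multiset of some list, and hence is
  the whole free module.\<close>

lemma sym_pow_functional_unique:
  assumes \<sigma>: "\<sigma> \<in> lin_maps R (sym_pow R M n) (ground R)"
    and \<tau>: "\<tau> \<in> lin_maps R (sym_pow R M n) (ground R)"
    and eq: "\<And>xs. length xs = n \<Longrightarrow> set xs \<subseteq> carrier M \<Longrightarrow> \<sigma> (sym_prod R M xs) = \<tau> (sym_prod R M xs)"
    and w: "w \<in> carrier (sym_pow R M n)"
  shows "\<sigma> w = \<tau> w"
proof -
  define p where "p u = sym_null R M n +>\<^bsub>words n\<^esub> u" for u
  have lift: "(\<lambda>u. \<rho> (p u)) \<in> lin_maps R (words n) (ground R)"
    if "\<rho> \<in> lin_maps R (sym_pow R M n) (ground R)" for \<rho>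
  proof (rule lin_mapsI)
    fix u v assume "u \<in> carrier (words n)" "v \<in> carrier (words n)"
    note uv = this
    have pu: "p u \<in> carrier (sym_pow R M n)" "p v \<in> carrier (sym_pow R M n)"
      unfolding p_def sym_pow_def by (rule sym.coset_closed[OF uv(1)], rule sym.coset_closed[OF uv(2)])
    show "\<rho> (p u) \<in> carrier (ground R)" by (rule lin_mapsD(1)[OF that pu(1)])
    have "p (u \<oplus>\<^bsub>words n\<^esub> v) = p u \<oplus>\<^bsub>sym_pow R M n\<^esub> p v"
      unfolding p_def sym_pow_def by (rule sym.coset_add[OF uv, symmetric])
    then show "\<rho> (p (u \<oplus>\<^bsub>words n\<^esub> v)) = \<rho> (p u) \<oplus>\<^bsub>ground R\<^esub> \<rho> (p v)"
      using lin_mapsD(2)[OF that pu] by simp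
    fix c assume c: "c \<in> carrier R"
    have "p (c \<odot>\<^bsub>words n\<^esub> u) = c \<odot>\<^bsub>sym_pow R M n\<^esub> p u"
      unfolding p_def sym_pow_def by (rule sym.coset_smult[OF c uv(1), symmetric])
    then show "\<rho> (p (c \<odot>\<^bsub>words n\<^esub> u)) = c \<odot>\<^bsub>ground R\<^esub> \<rho> (p u)"
      using lin_mapsD(3)[OF that c pu(1)] by simp
  qed
  obtain u where u: "u \<in> carrier (words n)" "w = p u"
    using w[unfolded sym_pow_def sym.mem_quot_mod, folded p_def] by blast
  have "u \<in> {u \<in> carrier (words n). \<sigma> (p u) = \<tau> (p u)}"
  proof (rule R.free_mod_generated[OF sym.equalizer_submodule[OF lift[OF \<sigma>] lift[OF \<tau>]] _ u(1)])
    fix X assume X: "X \<in> sym_words M n"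
    obtain xs where xs: "mset xs = X" using ex_mset by blast
    have "\<sigma> (sym_prod R M xs) = \<tau> (sym_prod R M xs)"
      using X xs by (intro eq) (auto simp: mem_sym_words)
    then show "free_gen R X \<in> {u \<in> carrier (words n). \<sigma> (p u) = \<tau> (p u)}"
      using X xs by (auto simp: sym_prod_def Let_def p_def mem_sym_words)
  qed
  then show ?thesis using u by simp
qed

text \<open>A function of multisets is symmetric by its type, so linearity in one factor amounts to
  multilinearity. The free extension of \<open>\<psi>\<close> to words kills the relations and
  therefore descends to the quotient.\<close>

lemma sym_pow_functional_exists:
  assumes \<psi>: "\<And>X. X \<in> sym_words M n \<Longrightarrow> \<psi> X \<in> carrier R"
    and add_rel: "\<And>x y X. x \<in> carrier M \<Longrightarrow> y \<in> carrier M \<Longrightarrow> set_mset X \<subseteq> carrier M \<Longrightarrow> Suc (size X) = n \<Longrightarrow>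
      \<psi> (add_mset (x \<oplus>\<^bsub>M\<^esub> y) X) = \<psi> (add_mset x X) \<oplus> \<psi> (add_mset y X)"
    and smult_rel: "\<And>c x X. c \<in> carrier R \<Longrightarrow> x \<in> carrier M \<Longrightarrow> set_mset X \<subseteq> carrier M \<Longrightarrow> Suc (size X) = n \<Longrightarrow>
      \<psi> (add_mset (c \<odot>\<^bsub>M\<^esub> x) X) = c \<otimes> \<psi> (add_mset x X)"
  obtains \<sigma> where "\<sigma> \<in> lin_maps R (sym_pow R M n) (ground R)"
    and "\<And>xs. length xs = n \<Longrightarrow> set xs \<subseteq> carrier M \<Longrightarrow> \<sigma> (sym_prod R M xs) = \<psi> (mset xs)"
proof -
  obtain \<Phi> where \<Phi>: "\<Phi> \<in> lin_maps R (words n) (ground R)"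
    and gen: "\<And>X. X \<in> sym_words M n \<Longrightarrow> \<Phi> (free_gen R X) = \<psi> X"
    using R.free_mod_extend[of "sym_words M n" \<psi>] \<psi> by blast
  have "sym_rels R M n \<subseteq> {u \<in> carrier (words n). \<Phi> u = \<zero>}"
  proof
    fix u assume u: "u \<in> sym_rels R M n"
    then have uF: "u \<in> carrier (words n)" using sym_rels_closed by blast
    from u have "\<Phi> u = \<zero>"
    proof (cases rule: sym_relsE)
      case (add x y X)
      have w: "add_mset x X \<in> sym_words M n" "add_mset y X \<in> sym_words M n"
        "add_mset (x \<oplus>\<^bsub>M\<^esub> y) X \<in> sym_words M n"
        using add(1-4) by (simp_all add: mem_sym_words)
      then show ?thesis
        using lin_mapsD(2)[OF \<Phi>] add_rel[OF add(1-4)] \<psi> unfolding add(5)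
        by (simp add: sym.functional_minus[OF \<Phi>] gen R.minus_eq R.r_neg)
    next
      case (smult c x X)
      have w: "add_mset x X \<in> sym_words M n" "add_mset (c \<odot>\<^bsub>M\<^esub> x) X \<in> sym_words M n"
        using smult(1-4) by (simp_all add: mem_sym_words)
      then show ?thesis
        using lin_mapsD(3)[OF \<Phi>] smult_rel[OF smult(1-4)] smult(1) \<psi> unfolding smult(5)
        by (simp add: sym.functional_minus[OF \<Phi>] gen R.minus_eq R.r_neg)
    qed
    with uF show "u \<in> {u \<in> carrier (words n). \<Phi> u = \<zero>}" by simp
  qed
  \<comment> \<open>The kernel of \<open>\<Phi>\<close> is a submodule containing the relations,
    hence contains the submodule they generate.\<close>
  then have "sym_null R M n \<subseteq> {u \<in> carrier (words n). \<Phi> u = \<zero>}"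
    unfolding sym_null_def
    by (rule sym.submod_gen_least[OF sym.equalizer_submodule[OF \<Phi> sym.zero_functional]])
  then have null: "\<Phi> u = \<zero>" if "u \<in> sym_null R M n" for u using that by blast
  obtain \<sigma> where \<sigma>: "\<sigma> \<in> lin_maps R (sym_pow R M n) (ground R)"
    and val: "\<And>u. u \<in> carrier (words n) \<Longrightarrow> \<sigma> (sym_null R M n +>\<^bsub>words n\<^esub> u) = \<Phi> u"
    using sym.functional_factors[OF \<Phi> null, folded sym_pow_def] by metis
  have "\<sigma> (sym_prod R M xs) = \<psi> (mset xs)" if "length xs = n" "set xs \<subseteq> carrier M" for xs
  proof -
    have "mset xs \<in> sym_words M n" using that by (simp add: mem_sym_words)
    then show ?thesis using that by (simp add: sym_prod_def Let_def val gen)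
  qed
  with \<sigma> show ?thesis by (rule that)
qed

end

section \<open>Commutators of functionals at a point\<close>

locale algebra_point = R: cring K + A: cring A + algebra K A for K (structure) and A (structure) +
  fixes h assumes point: "h \<in> points K A"
begin

abbreviation "func \<equiv> lin_maps K A (ground K)"

lemma h_func: "h \<in> func" and h_ring_hom: "h \<in> ring_hom A K"
  using point by (auto simp: points_def alg_homs_def ring_hom_def)

lemma h_simps [simp]:
  "f \<in> carrier A \<Longrightarrow> h f \<in> carrier K"
  "f \<in> carrier A \<Longrightarrow> g \<in> carrier A \<Longrightarrow> h (f \<oplus>\<^bsub>A\<^esub> g) = h f \<oplus> h g"
  "f \<in> carrier A \<Longrightarrow> g \<in> carrier A \<Longrightarrow> h (f \<otimes>\<^bsub>A\<^esub> g) = h f \<otimes> h g"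
  "c \<in> carrier K \<Longrightarrow> f \<in> carrier A \<Longrightarrow> h (c \<odot>\<^bsub>A\<^esub> f) = c \<otimes> h f"
  "h \<one>\<^bsub>A\<^esub> = \<one>"
  using h_func h_ring_hom by (auto simp: lin_maps_def ring_hom_def)

interpretation h: ring_hom_cring A K h
  using h_ring_hom A.cring_axioms R.cring_axioms by (simp add: ring_hom_cring.intro ring_hom_cring_axioms.intro)

lemma h_zero [simp]: "h \<zero>\<^bsub>A\<^esub> = \<zero>"
  and h_minus [simp]: "f \<in> carrier A \<Longrightarrow> g \<in> carrier A \<Longrightarrow> h (f \<ominus>\<^bsub>A\<^esub> g) = h f \<ominus> h g"
  by (simp_all add: A.minus_eq R.minus_eq)

abbreviation "\<delta> \<equiv> dlt_at K A h"

lemma smult_right: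
  assumes "c \<in> carrier K" "x \<in> carrier A" "y \<in> carrier A"
  shows "x \<otimes>\<^bsub>A\<^esub> (c \<odot>\<^bsub>A\<^esub> y) = c \<odot>\<^bsub>A\<^esub> (x \<otimes>\<^bsub>A\<^esub> y)"
  using assms by (simp add: A.m_comm[of x] smult_assoc2)

text \<open>Turns scalar multiplication into ring multiplication, which makes every ideal of A a
  K-submodule.\<close>

lemma smult_conv: "c \<in> carrier K \<Longrightarrow> x \<in> carrier A \<Longrightarrow> c \<odot>\<^bsub>A\<^esub> x = (c \<odot>\<^bsub>A\<^esub> \<one>\<^bsub>A\<^esub>) \<otimes>\<^bsub>A\<^esub> x"
  by (simp add: smult_assoc2)

lemma func_simps:
  assumes "G \<in> func"
  shows "x \<in> carrier A \<Longrightarrow> G x \<in> carrier K"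
    and "x \<in> carrier A \<Longrightarrow> y \<in> carrier A \<Longrightarrow> G (x \<oplus>\<^bsub>A\<^esub> y) = G x \<oplus> G y"
    and "c \<in> carrier K \<Longrightarrow> x \<in> carrier A \<Longrightarrow> G (c \<odot>\<^bsub>A\<^esub> x) = c \<otimes> G x"
  using lin_mapsD[OF assms] by simp_all

lemma dlt_at_func:
  assumes G: "G \<in> func" and f: "f \<in> carrier A"
  shows "\<delta> f G \<in> func"
proof (rule lin_mapsI)
  fix x y assume "x \<in> carrier A" "y \<in> carrier A"
  moreover have "(a \<oplus> b) \<ominus> u \<otimes> (c \<oplus> e) = (a \<ominus> u \<otimes> c) \<oplus> (b \<ominus> u \<otimes> e)"
    if "a \<in> carrier K" "b \<in> carrier K" "c \<in> carrier K" "e \<in> carrier K" "u \<in> carrier K" for a b c e u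
    using that by algebra
  ultimately show "\<delta> f G (x \<oplus>\<^bsub>A\<^esub> y) = \<delta> f G x \<oplus>\<^bsub>ground K\<^esub> \<delta> f G y"
    using f func_simps[OF G] by (simp add: dlt_at_def A.r_distr)
next
  fix c x assume "c \<in> carrier K" "x \<in> carrier A"
  moreover have "c \<otimes> a \<ominus> u \<otimes> (c \<otimes> b) = c \<otimes> (a \<ominus> u \<otimes> b)"
    if "a \<in> carrier K" "b \<in> carrier K" "c \<in> carrier K" "u \<in> carrier K" for a b c u
    using that by algebra
  ultimately show "\<delta> f G (c \<odot>\<^bsub>A\<^esub> x) = c \<odot>\<^bsub>ground K\<^esub> \<delta> f G x"
    using f func_simps[OF G] by (simp add: dlt_at_def smult_right)
next
  fix x assume "x \<in> carrier A"
  then show "\<delta> f G x \<in> carrier (ground K)"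
    using f func_simps(1)[OF G] by (simp add: dlt_at_def)
qed

lemma foldr_dlt_at_func:
  "G \<in> func \<Longrightarrow> set fs \<subseteq> carrier A \<Longrightarrow> foldr \<delta> fs G \<in> func"
  by (induction fs) (simp_all add: dlt_at_func)

text \<open>Both sides expand to G(fgp) - h(g) G(fp) - h(f) G(gp) + h(f) h(g) G(p), which is
  symmetric in f and g because A is commutative.\<close>

lemma dlt_at_commute:
  assumes G: "G \<in> func" and "f \<in> carrier A" "g \<in> carrier A" "p \<in> carrier A"
  shows "\<delta> f (\<delta> g G) p = \<delta> g (\<delta> f G) p"
proof -
  have "a \<ominus> v \<otimes> b \<ominus> u \<otimes> (c \<ominus> v \<otimes> e) = a \<ominus> u \<otimes> c \<ominus> v \<otimes> (b \<ominus> u \<otimes> e)"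
    if "a \<in> carrier K" "b \<in> carrier K" "c \<in> carrier K" "e \<in> carrier K" "u \<in> carrier K" "v \<in> carrier K"
    for a b c e u v
    using that by algebra
  moreover have "f \<otimes>\<^bsub>A\<^esub> (g \<otimes>\<^bsub>A\<^esub> p) = g \<otimes>\<^bsub>A\<^esub> (f \<otimes>\<^bsub>A\<^esub> p)"
    using assms(2-) by (rule A.m_lcomm)
  ultimately show ?thesis
    using assms(2-) func_simps(1)[OF G] by (simp add: dlt_at_def)
qed

lemma foldr_dlt_at_append_Cons:
  assumes G: "G \<in> func" and "set as \<subseteq> carrier A" "f \<in> carrier A" "set bs \<subseteq> carrier A" "p \<in> carrier A"
  shows "foldr \<delta> (as @ f # bs) G p = foldr \<delta> (f # as @ bs) G p"
  using assms(2-)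
proof (induction as arbitrary: p)
  case (Cons a as)
  \<comment> \<open>The commutator with \<open>a\<close> evaluates its argument at \<open>p\<close>
    and at the product of \<open>a\<close> and \<open>p\<close>, so the induction hypothesis is used
    at both points.\<close>
  have "foldr \<delta> (a # as @ f # bs) G p = \<delta> a (\<delta> f (foldr \<delta> (as @ bs) G)) p"
    using Cons.IH[of p] Cons.IH[of "a \<otimes>\<^bsub>A\<^esub> p"] Cons.prems
    by (simp add: dlt_at_def[of K A h a])
  also have "\<dots> = \<delta> f (\<delta> a (foldr \<delta> (as @ bs) G)) p"
    using Cons.prems foldr_dlt_at_func[OF G, of "as @ bs"] by (intro dlt_at_commute) auto
  finally show ?case by simp
qed simp

text \<open>The head of the first list is located in the second and moved to its front; the tails
  are then permutations of each other.\<close>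

lemma foldr_dlt_at_mset:
  assumes G: "G \<in> func" and "set fs \<subseteq> carrier A" "mset fs = mset gs" "p \<in> carrier A"
  shows "foldr \<delta> fs G p = foldr \<delta> gs G p"
  using assms(2-)
proof (induction fs arbitrary: gs p)
  case (Cons f fs)
  from Cons.prems have "f \<in> set gs" by (metis list.set_intros(1) mset_eq_setD)
  then obtain as bs where gs: "gs = as @ f # bs" by (meson split_list)
  have sub: "set gs \<subseteq> carrier A" using Cons.prems by (metis mset_eq_setD)
  have IH: "foldr \<delta> fs G q = foldr \<delta> (as @ bs) G q" if "q \<in> carrier A" for q
    using Cons.IH[of "as @ bs" q] Cons.prems that by (simp add: gs)
  have "foldr \<delta> (f # fs) G p = foldr \<delta> (f # as @ bs) G p"
    using IH Cons.prems by (simp add: dlt_at_def)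
  also have "\<dots> = foldr \<delta> gs G p"
    using foldr_dlt_at_append_Cons[OF G, of as f bs p] sub Cons.prems by (simp add: gs)
  finally show ?case .
qed simp

text \<open>Multiplicativity of h turns F(fp) - f F(p) into h(F(fp)) - h(f) h(F(p)), so composing
  with h carries \<delta>(f) to \<delta>_h(f). Closure in A is proved along with it because h is
  constrained on the carrier only.\<close>

lemma comp_dlt:
  assumes L: "L \<in> lin_maps K A A" and fs: "set fs \<subseteq> carrier A" and "p \<in> carrier A"
  shows "foldr (dlt A) fs L p \<in> carrier A \<and> foldr \<delta> fs (h \<circ> L) p = h (foldr (dlt A) fs L p)"
  using fs assms(3)
proof (induction fs arbitrary: p)
  case Nil then show ?case using lin_mapsD[OF L] by simp
next
  case (Cons f fs) then show ?case by (simp add: dlt_def dlt_at_def)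
qed

section \<open>The module of differentials at a point\<close>

abbreviation "I \<equiv> a_kernel A K h"
abbreviation "\<Omega> \<equiv> Omega K A h"
abbreviation "d \<equiv> univ_der K A h"

lemma I_iff: "f \<in> I \<longleftrightarrow> f \<in> carrier A \<and> h f = \<zero>"
  unfolding a_kernel_def' by blast

lemma I_ideal: "ideal I A"
  using h.ring.kernel_is_ideal .

lemma II_ideal: "ideal (I \<cdot>\<^bsub>A\<^esub> I) A"
  by (rule A.ideal_prod_is_ideal[OF I_ideal I_ideal])

lemma II_sub_I: "I \<cdot>\<^bsub>A\<^esub> I \<subseteq> I"
  using A.ideal_prod_inter[OF I_ideal I_ideal] by (rule order_trans) (rule Int_lower1)

lemma ideal_submodule:
  assumes "ideal J A" shows "submodule J K A"
proof -
  interpret J: ideal J A by fact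
  show ?thesis
  proof (rule submoduleI)
    show "J \<subseteq> carrier A" by (rule J.a_subset)
    show "\<zero>\<^bsub>A\<^esub> \<in> J" by (rule J.zero_closed)
    show "\<ominus>\<^bsub>A\<^esub> a \<in> J" if "a \<in> J" for a using that by (rule J.a_inv_closed)
    show "a \<oplus>\<^bsub>A\<^esub> b \<in> J" if "a \<in> J" "b \<in> J" for a b using that by (rule J.a_closed)
    show "c \<odot>\<^bsub>A\<^esub> x \<in> J" if c: "c \<in> carrier K" and x: "x \<in> J" for c x
      unfolding smult_conv[OF c J.Icarr[OF x]] using c by (intro J.I_l_closed x) simp
  qed
qed

lemma I_module: "module K (A\<lparr>carrier := I\<rparr>)"
  by (rule submodule.submodule_is_module[OF ideal_submodule[OF I_ideal] module])

text \<open>Negation is a definite description over the carrier, so restricting the carrier to I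
  changes its definition; uniqueness of negatives shows that the value stays the same.\<close>

lemma I_a_inv:
  assumes "x \<in> I" shows "\<ominus>\<^bsub>A\<lparr>carrier := I\<rparr>\<^esub> x = \<ominus>\<^bsub>A\<^esub> x"
proof -
  interpret IM: module K "A\<lparr>carrier := I\<rparr>" by (rule I_module)
  have "\<ominus>\<^bsub>A\<^esub> x \<in> I"
    using assms by (simp add: I_iff)
  then show ?thesis
    using assms IM.minus_equality[of "\<ominus>\<^bsub>A\<^esub> x" x] by (simp add: I_iff A.l_neg)
qed

sublocale Q: quotient_module K "A\<lparr>carrier := I\<rparr>" "I \<cdot>\<^bsub>A\<^esub> I"
proof (intro quotient_module.intro I_module quotient_module_axioms.intro)
  interpret IM: module K "A\<lparr>carrier := I\<rparr>" by (rule I_module)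
  interpret J: submodule "I \<cdot>\<^bsub>A\<^esub> I" K A by (rule ideal_submodule[OF II_ideal])
  show "submodule (I \<cdot>\<^bsub>A\<^esub> I) K (A\<lparr>carrier := I\<rparr>)"
  proof (rule IM.submoduleI)
    show "\<ominus>\<^bsub>A\<lparr>carrier := I\<rparr>\<^esub> a \<in> I \<cdot>\<^bsub>A\<^esub> I" if "a \<in> I \<cdot>\<^bsub>A\<^esub> I" for a
      using I_a_inv[OF subsetD[OF II_sub_I that]] submoduleE(3)[OF J.submodule_axioms that] by simp
  qed (use II_sub_I J.one_closed J.m_closed J.smult_closed in simp_all)
qed

lemma coset_restrict: "N +>\<^bsub>A\<lparr>carrier := C\<rparr>\<^esub> x = N +>\<^bsub>A\<^esub> x"
  by (simp add: a_r_coset_defs)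

text \<open>The projection of A onto I along the scalar multiples of 1; it picks the representative
  of the class \<open>d f\<close> that lies in I.\<close>

definition \<rho> where "\<rho> f = f \<ominus>\<^bsub>A\<^esub> (h f \<odot>\<^bsub>A\<^esub> \<one>\<^bsub>A\<^esub>)"

lemma \<rho>_I: "f \<in> carrier A \<Longrightarrow> \<rho> f \<in> I"
  by (simp add: I_iff \<rho>_def R.minus_eq R.r_neg)

lemma \<rho>_I_id: "f \<in> I \<Longrightarrow> \<rho> f = f"
  by (simp add: I_iff \<rho>_def A.minus_eq)

lemma univ_der_eq: "d f = I \<cdot>\<^bsub>A\<^esub> I +>\<^bsub>A\<^esub> \<rho> f"
  by (simp add: univ_der_def \<rho>_def Let_def)

text \<open>The quotient is formed from elements of I, but \<open>f\<close> and
  \<open>\<rho> f\<close> have the same differential, so arbitrary functions represent covectors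
  too.\<close>

lemma carrier_Omega: "carrier \<Omega> = d ` carrier A"
proof -
  have "carrier \<Omega> = d ` I"
    by (simp add: Omega_def Let_def quot_mod_simps coset_restrict univ_der_eq \<rho>_I_id cong: image_cong)
  moreover have "d f = d (\<rho> f)" if "f \<in> carrier A" for f
    using that by (simp add: univ_der_eq \<rho>_I_id \<rho>_I)
  then have "d ` carrier A \<subseteq> d ` I" using \<rho>_I by blast
  ultimately show ?thesis using I_iff by auto
qed

lemma Omega_eq: "\<Omega> = quot_mod (A\<lparr>carrier := I\<rparr>) (I \<cdot>\<^bsub>A\<^esub> I)"
  by (simp add: Omega_def Let_def)

lemma zero_Omega: "\<zero>\<^bsub>\<Omega>\<^esub> = I \<cdot>\<^bsub>A\<^esub> I"
  by (simp add: Omega_eq quot_mod_simps)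

lemma univ_der_add:
  assumes "f \<in> I" "g \<in> I"
  shows "d f \<oplus>\<^bsub>\<Omega>\<^esub> d g = d (f \<oplus>\<^bsub>A\<^esub> g)"
  using Q.coset_add[of f g] assms I_iff
  by (simp add: Omega_eq univ_der_eq \<rho>_I_id coset_restrict)

lemma univ_der_smult:
  assumes "c \<in> carrier K" "f \<in> I"
  shows "c \<odot>\<^bsub>\<Omega>\<^esub> d f = d (c \<odot>\<^bsub>A\<^esub> f)"
  using Q.coset_smult[of c f] assms I_iff
  by (simp add: Omega_eq univ_der_eq \<rho>_I_id coset_restrict)

lemma univ_der_zero_iff: "f \<in> I \<Longrightarrow> d f = \<zero>\<^bsub>\<Omega>\<^esub> \<longleftrightarrow> f \<in> I \<cdot>\<^bsub>A\<^esub> I"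
  using Q.coset_zero_iff[of f] by (simp add: zero_Omega univ_der_eq \<rho>_I_id coset_restrict)

lemma OmegaE:
  assumes "\<alpha> \<in> carrier \<Omega>" obtains f where "f \<in> I" "\<alpha> = d f"
proof -
  have "carrier \<Omega> = d ` I"
    by (simp add: Omega_eq quot_mod_simps coset_restrict univ_der_eq \<rho>_I_id cong: image_cong)
  then show ?thesis using that assms by auto
qed

lemma univ_der_eqD:
  assumes "f \<in> carrier A" "g \<in> carrier A" "d f = d g"
  shows "\<rho> f \<ominus>\<^bsub>A\<^esub> \<rho> g \<in> I \<cdot>\<^bsub>A\<^esub> I"
  using Q.coset_eq_iff[of "\<rho> f" "\<rho> g"] \<rho>_I[OF assms(1)] \<rho>_I[OF assms(2)] assms(3)
  by (simp add: univ_der_eq coset_restrict a_minus_def I_a_inv)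

section \<open>The derivation f -> (\<delta>(f) G)(1)\<close>

lemma dlt_at_one_add:
  assumes G: "G \<in> func" and "f \<in> carrier A" "g \<in> carrier A"
  shows "\<delta> (f \<oplus>\<^bsub>A\<^esub> g) G \<one>\<^bsub>A\<^esub> = \<delta> f G \<one>\<^bsub>A\<^esub> \<oplus> \<delta> g G \<one>\<^bsub>A\<^esub>"
proof -
  have "(a \<oplus> b) \<ominus> (u \<oplus> v) \<otimes> c = (a \<ominus> u \<otimes> c) \<oplus> (b \<ominus> v \<otimes> c)"
    if "a \<in> carrier K" "b \<in> carrier K" "c \<in> carrier K" "u \<in> carrier K" "v \<in> carrier K" for a b c u v
    using that by algebra
  then show ?thesis
    using assms(2-) func_simps[OF G] by (simp add: dlt_at_def)
qed

lemma dlt_at_one_smult: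
  assumes G: "G \<in> func" and "c \<in> carrier K" "f \<in> carrier A"
  shows "\<delta> (c \<odot>\<^bsub>A\<^esub> f) G \<one>\<^bsub>A\<^esub> = c \<otimes> \<delta> f G \<one>\<^bsub>A\<^esub>"
proof -
  have "c \<otimes> a \<ominus> c \<otimes> u \<otimes> b = c \<otimes> (a \<ominus> u \<otimes> b)"
    if "a \<in> carrier K" "b \<in> carrier K" "u \<in> carrier K" for a b u
    using that assms(2) by algebra
  then show ?thesis
    using assms(2-) func_simps[OF G] by (simp add: dlt_at_def)
qed

lemma dlt_at_one_const:
  assumes G: "G \<in> func"
  shows "\<delta> \<one>\<^bsub>A\<^esub> G \<one>\<^bsub>A\<^esub> = \<zero>"
  using func_simps[OF G] by (simp add: dlt_at_def R.minus_eq R.r_neg)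

text \<open>The Leibniz rule
  \<open>\<delta>(i j) G = \<delta>(i) \<delta>(j) G + h(i) \<delta>(j) G + h(j) \<delta>(i) G\<close> makes \<open>f \<mapsto> (\<delta>(f) G)(1)\<close> an
  \<open>h\<close>-derivation once second commutators of \<open>G\<close> vanish at \<open>1\<close>.\<close>

lemma dlt_at_one_II:
  assumes G: "G \<in> func" and vanish: "\<And>a b. a \<in> carrier A \<Longrightarrow> b \<in> carrier A \<Longrightarrow> \<delta> a (\<delta> b G) \<one>\<^bsub>A\<^esub> = \<zero>"
    and f: "f \<in> I \<cdot>\<^bsub>A\<^esub> I"
  shows "\<delta> f G \<one>\<^bsub>A\<^esub> = \<zero>"
  using f
proof (induction rule: ideal_prod.induct)
  case (prod i j)
  then have ij: "i \<in> carrier A" "j \<in> carrier A" "h i = \<zero>" "h j = \<zero>" by (auto simp: I_iff)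
  have "\<delta> (i \<otimes>\<^bsub>A\<^esub> j) G \<one>\<^bsub>A\<^esub> = \<delta> j (\<delta> i G) \<one>\<^bsub>A\<^esub>"
    using ij func_simps[OF G] by (simp add: dlt_at_def R.minus_eq)
  then show ?case using vanish ij by simp
next
  case (sum s1 s2)
  then have "s1 \<in> carrier A" "s2 \<in> carrier A"
    using subsetD[OF II_sub_I] I_iff by blast+
  then show ?case using sum.IH by (simp add: dlt_at_one_add[OF G])
qed

text \<open>The map \<open>D\<close> is linear and vanishes on the scalar multiples of 1, so
  \<open>D f = D (\<rho> f)\<close>. Equal differentials mean that \<open>\<rho> f\<close> and
  \<open>\<rho> g\<close> differ by an element of I^2, where \<open>D\<close> vanishes as
  well.\<close>

lemma dlt_at_one_cong:
  assumes G: "G \<in> func" and vanish: "\<And>a b. a \<in> carrier A \<Longrightarrow> b \<in> carrier A \<Longrightarrow> \<delta> a (\<delta> b G) \<one>\<^bsub>A\<^esub> = \<zero>"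
    and fg: "f \<in> carrier A" "g \<in> carrier A" "d f = d g"
  shows "\<delta> f G \<one>\<^bsub>A\<^esub> = \<delta> g G \<one>\<^bsub>A\<^esub>"
proof -
  define D where "D f = \<delta> f G \<one>\<^bsub>A\<^esub>" for f
  have DK: "D f \<in> carrier K" if "f \<in> carrier A" for f
    using func_simps(1)[OF dlt_at_func[OF G that]] by (simp add: D_def)
  have \<rho>A: "\<rho> f \<in> carrier A" if "f \<in> carrier A" for f
    using \<rho>_I[OF that] by (simp add: I_iff)
  have "D f = D (\<rho> f)" if f: "f \<in> carrier A" for f
  proof -
    have "f = \<rho> f \<oplus>\<^bsub>A\<^esub> h f \<odot>\<^bsub>A\<^esub> \<one>\<^bsub>A\<^esub>"
      using f by (simp add: \<rho>_def A.minus_eq A.a_assoc A.l_neg)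
    then have "D f = D (\<rho> f) \<oplus> D (h f \<odot>\<^bsub>A\<^esub> \<one>\<^bsub>A\<^esub>)"
      using dlt_at_one_add[OF G \<rho>A, of f "h f \<odot>\<^bsub>A\<^esub> \<one>\<^bsub>A\<^esub>"] f by (simp add: D_def)
    then show ?thesis
      using f \<rho>A DK by (simp add: D_def dlt_at_one_smult[OF G] dlt_at_one_const[OF G])
  qed
  moreover have "D (\<rho> f) = D (\<rho> g)"
  proof -
    have "\<rho> f = (\<rho> f \<ominus>\<^bsub>A\<^esub> \<rho> g) \<oplus>\<^bsub>A\<^esub> \<rho> g"
      using fg \<rho>A by (simp add: A.minus_eq A.a_assoc A.l_neg)
    then have "D (\<rho> f) = D (\<rho> f \<ominus>\<^bsub>A\<^esub> \<rho> g) \<oplus> D (\<rho> g)"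
      using dlt_at_one_add[OF G, of "\<rho> f \<ominus>\<^bsub>A\<^esub> \<rho> g" "\<rho> g"] fg \<rho>A by (simp add: D_def)
    moreover have "D (\<rho> f \<ominus>\<^bsub>A\<^esub> \<rho> g) = \<zero>"
      unfolding D_def by (rule dlt_at_one_II[OF G vanish univ_der_eqD[OF fg]])
    ultimately show ?thesis using fg \<rho>A DK by simp
  qed
  ultimately show ?thesis using fg by (simp add: D_def)
qed

end

section \<open>The principal symbol\<close>

context algebra_point
begin

lemma module_Omega: "module K \<Omega>"
  unfolding Omega_eq by (rule Q.module_quot_mod)

lemma univ_der_closed: "f \<in> carrier A \<Longrightarrow> d f \<in> carrier \<Omega>"
  unfolding carrier_Omega by (rule imageI)

lemma map_univ_der_cover:
  assumes "set_mset X \<subseteq> carrier \<Omega>"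
  obtains fs where "set fs \<subseteq> carrier A" "mset (map d fs) = X"
proof -
  obtain xs where xs: "mset xs = X" using ex_mset by blast
  then have "set xs \<subseteq> d ` carrier A" using assms carrier_Omega by auto
  then obtain fs where "set fs \<subseteq> carrier A" "xs = map d fs" by (rule list_imageE)
  then show ?thesis using that xs by simp
qed

text \<open>Order \<le> k for functionals, tested at 1 only: this is where the symbol evaluates
  iterated commutators.\<close>

definition ord_le where
  "ord_le k G \<longleftrightarrow> G \<in> func \<and>
    (\<forall>fs. length fs = Suc k \<and> set fs \<subseteq> carrier A \<longrightarrow> foldr \<delta> fs G \<one>\<^bsub>A\<^esub> = \<zero>)"

lemma comp_ord_le:
  assumes L: "ldo_order_le K A k L"
  shows "ord_le k (h \<circ> L)"
proof -
  have lin: "L \<in> lin_maps K A A" using L by (simp add: ldo_order_le_def ldo_order_less_def)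
  have "h \<circ> L \<in> func"
    by (rule lin_mapsI) (simp_all add: lin_mapsD[OF lin])
  moreover have "foldr \<delta> fs (h \<circ> L) \<one>\<^bsub>A\<^esub> = \<zero>" if "length fs = Suc k" "set fs \<subseteq> carrier A" for fs
  proof -
    have "foldr (dlt A) fs L \<one>\<^bsub>A\<^esub> = \<zero>\<^bsub>A\<^esub>"
      using L that A.one_closed unfolding ldo_order_le_def ldo_order_less_def by blast
    then show ?thesis using comp_dlt[OF lin that(2) A.one_closed] by simp
  qed
  ultimately show ?thesis unfolding ord_le_def by blast
qed

text \<open>The functions are exchanged one at a time for others with the same differential. The
  prefix \<open>as\<close> collects those already exchanged, so that the total number of commutators
  remains k throughout the induction.\<close>

lemma foldr_dlt_at_univ_der_cong:
  assumes G: "ord_le k G" and "length (as @ fs) = k" "set (as @ fs) \<subseteq> carrier A" "set gs \<subseteq> carrier A"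
    and "mset (map d fs) = mset (map d gs)"
  shows "foldr \<delta> (as @ fs) G \<one>\<^bsub>A\<^esub> = foldr \<delta> (as @ gs) G \<one>\<^bsub>A\<^esub>"
  using assms(2-)
proof (induction fs arbitrary: as gs)
  case (Cons f fs)
  have func: "G \<in> func" using G by (simp add: ord_le_def)
  have "d f \<in> set (map d gs)"
    using Cons.prems(4) by (metis list.set_intros(1) list.simps(9) mset_eq_setD)
  then obtain g where g: "g \<in> set gs" "d f = d g" by auto
  then obtain bs cs where gs: "gs = bs @ g # cs" by (meson split_list)
  have car: "f \<in> carrier A" "g \<in> carrier A" "set as \<subseteq> carrier A" "set fs \<subseteq> carrier A"
    "set bs \<subseteq> carrier A" "set cs \<subseteq> carrier A"
    using Cons.prems(2,3) by (simp_all add: gs)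
  have func': "foldr \<delta> (as @ fs) G \<in> func"
    using car by (intro foldr_dlt_at_func func) simp
  \<comment> \<open>Without \<open>f\<close> there are k - 1 commutators left; \<open>a\<close> and
    \<open>b\<close> bring the number to k + 1.\<close>
  have vanish: "\<delta> a (\<delta> b (foldr \<delta> (as @ fs) G)) \<one>\<^bsub>A\<^esub> = \<zero>" if "a \<in> carrier A" "b \<in> carrier A" for a b
  proof -
    have "length (a # b # as @ fs) = Suc k" "set (a # b # as @ fs) \<subseteq> carrier A"
      using Cons.prems(1) car that by simp_all
    then have "foldr \<delta> (a # b # as @ fs) G \<one>\<^bsub>A\<^esub> = \<zero>" using G unfolding ord_le_def by blast
    then show ?thesis by simp
  qed
  have "foldr \<delta> (as @ f # fs) G \<one>\<^bsub>A\<^esub> = \<delta> f (foldr \<delta> (as @ fs) G) \<one>\<^bsub>A\<^esub>"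
    using foldr_dlt_at_append_Cons[OF func car(3,1,4) A.one_closed] by simp
  also have "\<dots> = \<delta> g (foldr \<delta> (as @ fs) G) \<one>\<^bsub>A\<^esub>"
    by (rule dlt_at_one_cong[OF func' vanish car(1,2) g(2)])
  \<comment> \<open>The exchanged \<open>g\<close> joins the prefix, which puts the expression into
    the form of the induction hypothesis.\<close>
  also have "\<dots> = foldr \<delta> ((as @ [g]) @ fs) G \<one>\<^bsub>A\<^esub>"
    using foldr_dlt_at_append_Cons[OF func car(3,2,4) A.one_closed] by simp
  also have "\<dots> = foldr \<delta> ((as @ [g]) @ (bs @ cs)) G \<one>\<^bsub>A\<^esub>"
    using Cons.prems car g(2) by (intro Cons.IH) (simp_all add: gs)
  also have "\<dots> = foldr \<delta> (as @ gs) G \<one>\<^bsub>A\<^esub>"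
    using car by (intro foldr_dlt_at_mset[OF func]) (simp_all add: gs)
  finally show ?case .
qed simp

lemma symbol_exists:
  assumes G: "ord_le k G"
  obtains \<sigma> where "\<sigma> \<in> lin_maps K (sym_pow K \<Omega> k) (ground K)"
    and "\<And>fs. length fs = k \<Longrightarrow> set fs \<subseteq> carrier A \<Longrightarrow>
      \<sigma> (sym_prod K \<Omega> (map d fs)) = foldr \<delta> fs G \<one>\<^bsub>A\<^esub>"
proof -
  interpret \<Omega>: module K \<Omega> by (rule module_Omega)
  have func: "G \<in> func" using G by (simp add: ord_le_def)
  \<comment> \<open>A multiset of covectors is lifted to some list of functions; by
    \<open>foldr_dlt_at_univ_der_cong\<close> the value is the same for all lifts of length
    k.\<close>
  define \<psi> where "\<psi> X = foldr \<delta> (SOME fs. set fs \<subseteq> carrier A \<and> mset (map d fs) = X) G \<one>\<^bsub>A\<^esub>" for X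
  have \<psi>: "\<psi> (mset (map d fs)) = foldr \<delta> fs G \<one>\<^bsub>A\<^esub>" if fs: "length fs = k" "set fs \<subseteq> carrier A" for fs
  proof -
    define gs where "gs = (SOME gs. set gs \<subseteq> carrier A \<and> mset (map d gs) = mset (map d fs))"
    have gs: "set gs \<subseteq> carrier A \<and> mset (map d gs) = mset (map d fs)"
      unfolding gs_def by (rule someI[of _ fs]) (use fs in blast)
    then have "foldr \<delta> ([] @ fs) G \<one>\<^bsub>A\<^esub> = foldr \<delta> ([] @ gs) G \<one>\<^bsub>A\<^esub>"
      using fs by (intro foldr_dlt_at_univ_der_cong[OF G]) simp_all
    then show ?thesis by (simp add: \<psi>_def gs_def)
  qed
  have \<psi>_Cons: "\<psi> (add_mset (d f) (mset (map d fs))) = \<delta> f (foldr \<delta> fs G) \<one>\<^bsub>A\<^esub>"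
    if "f \<in> carrier A" "set fs \<subseteq> carrier A" "Suc (length fs) = k" for f fs
    using \<psi>[of "f # fs"] that by simp
  have size_eq: "length fs = size X" if "mset (map d fs) = X" for fs X
    using that by (metis length_map size_mset)
  obtain \<sigma> where \<sigma>: "\<sigma> \<in> lin_maps K (sym_pow K \<Omega> k) (ground K)"
    and val: "\<And>xs. length xs = k \<Longrightarrow> set xs \<subseteq> carrier \<Omega> \<Longrightarrow> \<sigma> (sym_prod K \<Omega> xs) = \<psi> (mset xs)"
  proof (rule \<Omega>.sym_pow_functional_exists[of k \<psi>])
    fix X assume "X \<in> sym_words \<Omega> k"
    then have X: "size X = k" "set_mset X \<subseteq> carrier \<Omega>" by (simp_all add: sym_words_def)
    obtain fs where fs: "set fs \<subseteq> carrier A" "mset (map d fs) = X"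
      using X(2) by (rule map_univ_der_cover)
    have "\<psi> X = foldr \<delta> fs G \<one>\<^bsub>A\<^esub>" using \<psi>[of fs] fs X(1) size_eq[OF fs(2)] by simp
    then show "\<psi> X \<in> carrier K"
      using func_simps(1)[OF foldr_dlt_at_func[OF func fs(1)] A.one_closed] by simp
  next
    fix x y X assume xy: "x \<in> carrier \<Omega>" "y \<in> carrier \<Omega>" and X: "set_mset X \<subseteq> carrier \<Omega>" "Suc (size X) = k"
    \<comment> \<open>Representatives are taken in I, where \<open>\<rho>\<close> is the identity
      and \<open>d\<close> is simply the coset map.\<close>
    obtain f g where f: "f \<in> I" "x = d f" and g: "g \<in> I" "y = d g"
      using xy OmegaE by metis
    obtain fs where fs: "set fs \<subseteq> carrier A" "mset (map d fs) = X"
      using X(1) by (rule map_univ_der_cover)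
    have len: "Suc (length fs) = k" using size_eq[OF fs(2)] X(2) by simp
    have fg: "f \<in> carrier A" "g \<in> carrier A" using f g by (simp_all add: I_iff)
    have "x \<oplus>\<^bsub>\<Omega>\<^esub> y = d (f \<oplus>\<^bsub>A\<^esub> g)" using f g by (simp add: univ_der_add)
    then show "\<psi> (add_mset (x \<oplus>\<^bsub>\<Omega>\<^esub> y) X) = \<psi> (add_mset x X) \<oplus> \<psi> (add_mset y X)"
      using \<psi>_Cons[OF _ fs(1) len, unfolded fs(2)] fg f(2) g(2)
        dlt_at_one_add[OF foldr_dlt_at_func[OF func fs(1)] fg] by simp
  next
    fix c x X assume cx: "c \<in> carrier K" "x \<in> carrier \<Omega>" and X: "set_mset X \<subseteq> carrier \<Omega>" "Suc (size X) = k"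
    obtain f where f: "f \<in> I" "x = d f" using cx(2) by (rule OmegaE)
    obtain fs where fs: "set fs \<subseteq> carrier A" "mset (map d fs) = X"
      using X(1) by (rule map_univ_der_cover)
    have len: "Suc (length fs) = k" using size_eq[OF fs(2)] X(2) by simp
    have fA: "f \<in> carrier A" using f by (simp add: I_iff)
    have "c \<odot>\<^bsub>\<Omega>\<^esub> x = d (c \<odot>\<^bsub>A\<^esub> f)" using f cx(1) by (simp add: univ_der_smult)
    then show "\<psi> (add_mset (c \<odot>\<^bsub>\<Omega>\<^esub> x) X) = c \<otimes> \<psi> (add_mset x X)"
      using \<psi>_Cons[OF _ fs(1) len, unfolded fs(2)] fA f(2) cx(1)
        dlt_at_one_smult[OF foldr_dlt_at_func[OF func fs(1)] cx(1) fA] by simp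
  qed blast
  have "\<sigma> (sym_prod K \<Omega> (map d fs)) = foldr \<delta> fs G \<one>\<^bsub>A\<^esub>"
    if "length fs = k" "set fs \<subseteq> carrier A" for fs
  proof -
    have "set (map d fs) \<subseteq> carrier \<Omega>" using that(2) carrier_Omega by auto
    then show ?thesis using val[of "map d fs"] \<psi>[OF that] that(1) by simp
  qed
  with \<sigma> show ?thesis by (rule that)
qed

text \<open>Every covector is a differential, so products of differentials exhaust the products that
  generate the symmetric power.\<close>

lemma functional_eqI:
  assumes \<sigma>: "\<sigma> \<in> lin_maps K (sym_pow K \<Omega> k) (ground K)"
    and \<tau>: "\<tau> \<in> lin_maps K (sym_pow K \<Omega> k) (ground K)"
    and eq: "\<And>fs. length fs = k \<Longrightarrow> set fs \<subseteq> carrier A \<Longrightarrow>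
      \<sigma> (sym_prod K \<Omega> (map d fs)) = \<tau> (sym_prod K \<Omega> (map d fs))"
    and w: "w \<in> carrier (sym_pow K \<Omega> k)"
  shows "\<sigma> w = \<tau> w"
proof (rule module.sym_pow_functional_unique[OF module_Omega \<sigma> \<tau> _ w])
  fix xs assume xs: "length xs = k" "set xs \<subseteq> carrier \<Omega>"
  obtain fs where "set fs \<subseteq> carrier A" "xs = map d fs"
    using xs(2) unfolding carrier_Omega by (rule list_imageE)
  with xs(1) show "\<sigma> (sym_prod K \<Omega> xs) = \<tau> (sym_prod K \<Omega> xs)" using eq by simp
qed

text \<open>Justifies the definite description in \<open>symbol\<close>: existence comes from
  \<open>symbol_exists\<close>, uniqueness from \<open>functional_eqI\<close> together with
  extensionality.\<close>

lemma symbol_spec: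
  assumes L: "ldo_order_le K A k L"
  shows "symbol K A k L h \<in> lin_maps K (sym_pow K \<Omega> k) (ground K)"
    and "length fs = k \<Longrightarrow> set fs \<subseteq> carrier A \<Longrightarrow>
      symbol K A k L h (sym_prod K \<Omega> (map d fs)) = foldr \<delta> fs (h \<circ> L) \<one>\<^bsub>A\<^esub>"
proof -
  let ?S = "sym_pow K \<Omega> k"
  define P where "P \<sigma> \<longleftrightarrow> \<sigma> \<in> lin_maps K ?S (ground K) \<and> \<sigma> \<in> extensional (carrier ?S) \<and>
    (\<forall>fs. length fs = k \<and> set fs \<subseteq> carrier A \<longrightarrow>
      \<sigma> (sym_prod K \<Omega> (map d fs)) = foldr \<delta> fs (h \<circ> L) \<one>\<^bsub>A\<^esub>)" for \<sigma>
  interpret S: module K ?S by (rule module.module_sym_pow[OF module_Omega])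
  obtain \<tau> where \<tau>: "\<tau> \<in> lin_maps K ?S (ground K)"
    and val: "\<And>fs. length fs = k \<Longrightarrow> set fs \<subseteq> carrier A \<Longrightarrow>
      \<tau> (sym_prod K \<Omega> (map d fs)) = foldr \<delta> fs (h \<circ> L) \<one>\<^bsub>A\<^esub>"
    by (rule symbol_exists[OF comp_ord_le[OF L]]) blast
  have closed: "sym_prod K \<Omega> (map d fs) \<in> carrier ?S" if "length fs = k" "set fs \<subseteq> carrier A" for fs
    using module.sym_prod_closed[OF module_Omega, of "map d fs"] that carrier_Omega by auto
  \<comment> \<open>Restriction makes \<open>\<tau>\<close> extensional. It remains linear since the
    symmetric power is closed under its operations.\<close>
  have "restrict \<tau> (carrier ?S) \<in> lin_maps K ?S (ground K)"
    using lin_mapsD[OF \<tau>] by (intro lin_mapsI) simp_all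
  then have ex: "P (restrict \<tau> (carrier ?S))"
    unfolding P_def using val closed by simp
  have "\<sigma> = \<sigma>'" if "P \<sigma>" "P \<sigma>'" for \<sigma> \<sigma>'
    using that functional_eqI[of \<sigma> k \<sigma>'] unfolding P_def by (intro extensionalityI[of \<sigma> "carrier ?S"]) simp_all
  then have "P (THE \<sigma>. P \<sigma>)" using ex by (intro theI[of P, OF ex])
  moreover have "symbol K A k L h = (THE \<sigma>. P \<sigma>)"
    unfolding symbol_def P_def ..
  ultimately have "P (symbol K A k L h)" by simp
  then show "symbol K A k L h \<in> lin_maps K ?S (ground K)"
    and "length fs = k \<Longrightarrow> set fs \<subseteq> carrier A \<Longrightarrow>
      symbol K A k L h (sym_prod K \<Omega> (map d fs)) = foldr \<delta> fs (h \<circ> L) \<one>\<^bsub>A\<^esub>"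
    unfolding P_def by simp_all
qed

text \<open>Eliminates the symbol in favour of iterated commutators evaluated at 1, a form that can
  be compared along \<open>\<pi>\<close>. If all these values were zero, the symbol would agree with
  the zero functional on generators.\<close>

lemma of_order_at_iff:
  assumes L: "ldo_order_le K A k L"
  shows "of_order_at K A k L h \<longleftrightarrow>
    (\<exists>fs. length fs = k \<and> set fs \<subseteq> carrier A \<and> h (foldr (dlt A) fs L \<one>\<^bsub>A\<^esub>) \<noteq> \<zero>)"
proof -
  interpret S: module K "sym_pow K \<Omega> k" by (rule module.module_sym_pow[OF module_Omega])
  have lin: "L \<in> lin_maps K A A" using L by (simp add: ldo_order_le_def ldo_order_less_def)
  have val: "symbol K A k L h (sym_prod K \<Omega> (map d fs)) = h (foldr (dlt A) fs L \<one>\<^bsub>A\<^esub>)"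
    if "length fs = k" "set fs \<subseteq> carrier A" for fs
    using symbol_spec(2)[OF L that] comp_dlt[OF lin that(2) A.one_closed] by simp
  show ?thesis
  proof
    assume "of_order_at K A k L h"
    then obtain w where w: "w \<in> carrier (sym_pow K \<Omega> k)" "symbol K A k L h w \<noteq> \<zero>"
      unfolding of_order_at_def by blast
    show "\<exists>fs. length fs = k \<and> set fs \<subseteq> carrier A \<and> h (foldr (dlt A) fs L \<one>\<^bsub>A\<^esub>) \<noteq> \<zero>"
    proof (rule ccontr)
      assume "\<not> ?thesis"
      then have "symbol K A k L h w = (\<lambda>_. \<zero>) w"
        using val by (intro functional_eqI[OF symbol_spec(1)[OF L] S.zero_functional _ w(1)]) simp
      then show False using w(2) by simp
    qed
  next
    assume "\<exists>fs. length fs = k \<and> set fs \<subseteq> carrier A \<and> h (foldr (dlt A) fs L \<one>\<^bsub>A\<^esub>) \<noteq> \<zero>"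
    then obtain fs where fs: "length fs = k" "set fs \<subseteq> carrier A" "h (foldr (dlt A) fs L \<one>\<^bsub>A\<^esub>) \<noteq> \<zero>"
      by blast
    have "sym_prod K \<Omega> (map d fs) \<in> carrier (sym_pow K \<Omega> k)"
      using module.sym_prod_closed[OF module_Omega, of "map d fs"] fs(1,2) carrier_Omega by auto
    then show "of_order_at K A k L h"
      unfolding of_order_at_def using val[OF fs(1,2)] fs(3) by metis
  qed
qed

text \<open>The same elimination for the powers of a covector on which ellipticity is
  tested.\<close>

lemma symbol_power:
  assumes L: "ldo_order_le K A k L" and f: "f \<in> carrier A"
  shows "symbol K A k L h (sym_prod K \<Omega> (replicate k (d f))) =
    h (foldr (dlt A) (replicate k f) L \<one>\<^bsub>A\<^esub>)"
proof -
  have lin: "L \<in> lin_maps K A A" using L by (simp add: ldo_order_le_def ldo_order_less_def)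
  have fs: "length (replicate k f) = k" "set (replicate k f) \<subseteq> carrier A" using f by auto
  show ?thesis
    using symbol_spec(2)[OF L fs] comp_dlt[OF lin fs(2) A.one_closed] by simp
qed

end

section \<open>Operators intertwined by a surjective homomorphism\<close>

text \<open>A ring homomorphism sends L(fp) - f L(p) to L'(\<pi>(f) \<pi>(p)) - \<pi>(f)
  L'(\<pi>(p)) when it intertwines L and L'; hence the commutators are intertwined again.\<close>

lemma hom_foldr_dlt:
  assumes A: "ring A" and B: "ring B" and hom: "\<pi> \<in> ring_hom A B"
    and L: "\<And>s. s \<in> carrier A \<Longrightarrow> L s \<in> carrier A"
    and comm: "\<And>s. s \<in> carrier A \<Longrightarrow> \<pi> (L s) = L' (\<pi> s)"
    and fs: "set fs \<subseteq> carrier A" and p: "p \<in> carrier A"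
  shows "foldr (dlt A) fs L p \<in> carrier A \<and> \<pi> (foldr (dlt A) fs L p) = foldr (dlt B) (map \<pi> fs) L' (\<pi> p)"
  using fs p
proof (induction fs arbitrary: p)
  case Nil then show ?case by (simp add: L comm)
next
  case (Cons f fs)
  interpret \<pi>: ring_hom_ring A B \<pi> by (rule ring_hom_ringI2[OF A B hom])
  show ?case using Cons by (simp add: dlt_def a_minus_def)
qed

lemma points_comp:
  assumes \<pi>: "\<pi> \<in> alg_homs K S T" and h: "h \<in> points K T"
  shows "h \<circ> \<pi> \<in> points K S"
proof -
  have "h \<circ> \<pi> \<in> ring_hom S (ground K)"
    using assms ring_hom_trans unfolding points_def alg_homs_def by blast
  moreover have "h \<circ> \<pi> \<in> lin_maps K S (ground K)"
    using assms unfolding points_def alg_homs_def lin_maps_def by (simp add: Pi_iff)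
  ultimately show ?thesis by (simp add: points_def alg_homs_def)
qed

text \<open>The exact order is asserted when T has a point. Over a non-zero K the zero algebra T has
  none, the assumption on points is then vacuous, and L' = 0 has order < 0.\<close>

theorem theorem6p5:
  fixes K :: "('k,'m) ring_scheme"
    and S :: "('k,'s,'p) module_scheme"
    and T :: "('k,'t,'q) module_scheme"
    and \<pi> :: "'s \<Rightarrow> 't" and L :: "'s \<Rightarrow> 's" and L' :: "'t \<Rightarrow> 't" and k :: nat
  assumes "cring K" and "algebra K S" and "algebra K T"
    and "\<pi> \<in> alg_homs K S T" and "\<pi> ` carrier S = carrier T"
    and "ldo_of_order K S k L"
    and "\<forall>h\<in>points K T. of_order_at K S k L (h \<circ> \<pi>) \<and> elliptic_at K S k L (h \<circ> \<pi>)"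
    and "L' \<in> lin_maps K T T"
    and "\<forall>s\<in>carrier S. \<pi> (L s) = L' (\<pi> s)"
  shows "ldo_order_le K T k L' \<and> (points K T \<noteq> {} \<longrightarrow> elliptic_ldo K T k L')"
proof -
  interpret CS: cring S by (rule algebra.M_cring[OF assms(2)])
  interpret CT: cring T by (rule algebra.M_cring[OF assms(3)])
  have hom: "\<pi> \<in> ring_hom S T" and lin: "\<pi> \<in> lin_maps K S T"
    using assms(4) by (simp_all add: alg_homs_def)
  interpret \<pi>: ring_hom_ring S T \<pi>
    by (rule ring_hom_ringI2[OF CS.ring_axioms CT.ring_axioms hom])
  have Lle: "ldo_order_le K S k L" using assms(6) by (simp add: ldo_of_order_def)
  then have L: "L \<in> lin_maps K S S" by (simp add: ldo_order_le_def ldo_order_less_def)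
  have fold: "foldr (dlt S) fs L p \<in> carrier S"
    "\<pi> (foldr (dlt S) fs L p) = foldr (dlt T) (map \<pi> fs) L' (\<pi> p)"
    if "set fs \<subseteq> carrier S" "p \<in> carrier S" for fs p
    using hom_foldr_dlt[OF CS.ring_axioms CT.ring_axioms hom lin_mapsD(1)[OF L] _ that] assms(9) by simp_all
  have L'le: "ldo_order_le K T k L'"
    unfolding ldo_order_le_def ldo_order_less_def
  proof (intro conjI allI impI ballI assms(8))
    fix gs p assume gs: "length gs = Suc k \<and> set gs \<subseteq> carrier T" and p: "p \<in> carrier T"
    \<comment> \<open>Surjectivity lifts all functions in the commutator, and its argument, to S,
      where the (k + 1)-fold commutator of \<open>L\<close> vanishes.\<close>
    from gs have "set gs \<subseteq> \<pi> ` carrier S" using assms(5) by simp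
    then obtain fs where fs: "set fs \<subseteq> carrier S" "gs = map \<pi> fs" by (rule list_imageE)
    obtain q where q: "q \<in> carrier S" "p = \<pi> q" using p assms(5) by blast
    have "foldr (dlt S) fs L q = \<zero>\<^bsub>S\<^esub>"
      using Lle gs fs q unfolding ldo_order_le_def ldo_order_less_def by simp
    then show "foldr (dlt T) gs L' p = \<zero>\<^bsub>T\<^esub>" using fold(2)[OF fs(1) q(1)] fs q by simp
  qed
  \<comment> \<open>Both claims come from one k-fold commutator of \<open>L'\<close> whose value at
    1 is not killed by \<open>h\<close>, so they are proved together at a given point.\<close>
  have elliptic: "elliptic_at K T k L' h \<and> \<not> ldo_order_less K T k L'" if h: "h \<in> points K T" for h
  proof -
    interpret PT: algebra_point K T h
      using h assms(1) by (intro algebra_point.intro algebra_point_axioms.intro assms(3) CT.is_cring)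
    interpret PS: algebra_point K S "h \<circ> \<pi>"
      using points_comp[OF assms(4) h] assms(1)
      by (intro algebra_point.intro algebra_point_axioms.intro assms(2) CS.is_cring)
    have val: "(h \<circ> \<pi>) (foldr (dlt S) fs L \<one>\<^bsub>S\<^esub>) = h (foldr (dlt T) (map \<pi> fs) L' \<one>\<^bsub>T\<^esub>)"
      if "set fs \<subseteq> carrier S" for fs
      using fold(2)[OF that, of "\<one>\<^bsub>S\<^esub>"] by simp
    have ell: "elliptic_at K S k L (h \<circ> \<pi>)" using assms(7) h by blast
    then have "of_order_at K S k L (h \<circ> \<pi>)" by (simp add: elliptic_at_def)
    then obtain fs where fs: "length fs = k" "set fs \<subseteq> carrier S"
      "(h \<circ> \<pi>) (foldr (dlt S) fs L \<one>\<^bsub>S\<^esub>) \<noteq> \<zero>\<^bsub>K\<^esub>"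
      using PS.of_order_at_iff[OF Lle] by blast
    then have gs: "length (map \<pi> fs) = k" "set (map \<pi> fs) \<subseteq> carrier T"
      "h (foldr (dlt T) (map \<pi> fs) L' \<one>\<^bsub>T\<^esub>) \<noteq> \<zero>\<^bsub>K\<^esub>"
      using val assms(5) by auto
    then have order: "of_order_at K T k L' h"
      using PT.of_order_at_iff[OF L'le] by blast
    \<comment> \<open>Order < k would make this commutator vanish at 1, and \<open>h\<close> maps
      zero to zero.\<close>
    have "\<not> ldo_order_less K T k L'"
      using gs PT.h_zero CT.one_closed unfolding ldo_order_less_def by metis
    moreover have "elliptic_at K T k L' h"
      unfolding elliptic_at_def
    proof (intro conjI order ballI impI)
      fix \<alpha> assume \<alpha>: "\<alpha> \<in> carrier (Omega K T h)" "\<alpha> \<noteq> \<zero>\<^bsub>Omega K T h\<^esub>"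
      \<comment> \<open>With \<open>g\<close> in ker h, any preimage \<open>f\<close> lies in the
        kernel of \<open>h \<circ> \<pi>\<close>, so the vanishing criterion for differentials
        applies to both.\<close>
      obtain g where g: "g \<in> a_kernel T K h" "\<alpha> = univ_der K T h g"
        using \<alpha>(1) by (rule PT.OmegaE)
      then obtain f where f: "f \<in> carrier S" "g = \<pi> f"
        using assms(5) PT.I_iff by blast
      have fI: "f \<in> a_kernel S K (h \<circ> \<pi>)" using f g(1) by (simp add: PS.I_iff PT.I_iff)
      define \<beta> where "\<beta> = univ_der K S (h \<circ> \<pi>) f"
      have \<pi>I: "\<pi> s \<in> a_kernel T K h \<cdot>\<^bsub>T\<^esub> a_kernel T K h"
        if "s \<in> a_kernel S K (h \<circ> \<pi>) \<cdot>\<^bsub>S\<^esub> a_kernel S K (h \<circ> \<pi>)" for s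
        using that
      proof (induction rule: ideal_prod.induct)
        case (prod i j)
        then show ?case
          using ideal_prod.prod[of "\<pi> i" "a_kernel T K h" "\<pi> j" _ T]
          by (simp add: PS.I_iff PT.I_iff)
      next
        case (sum s t)
        then have "s \<in> carrier S" "t \<in> carrier S"
          using subsetD[OF PS.II_sub_I] PS.I_iff by blast+
        then show ?case using sum.IH ideal_prod.sum by simp
      qed
      \<comment> \<open>If \<open>\<beta>\<close> were zero, \<open>f\<close> would lie in the
        square of its kernel, hence \<open>g\<close> in the square of ker h, contradicting \<alpha>
        \<noteq> 0.\<close>
      have "\<beta> \<noteq> \<zero>\<^bsub>Omega K S (h \<circ> \<pi>)\<^esub>"
        using \<alpha>(2) g PT.univ_der_zero_iff[OF g(1)] PS.univ_der_zero_iff[OF fI] \<pi>I f(2)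
        unfolding \<beta>_def by metis
      moreover have "\<beta> \<in> carrier (Omega K S (h \<circ> \<pi>))"
        unfolding \<beta>_def using f(1) by (rule PS.univ_der_closed)
      ultimately have "inj_on (\<lambda>c. c \<otimes>\<^bsub>K\<^esub> symbol K S k L (h \<circ> \<pi>)
          (sym_prod K (Omega K S (h \<circ> \<pi>)) (replicate k \<beta>))) (carrier K)"
        using ell unfolding elliptic_at_def by blast
      \<comment> \<open>Both symbols are k-fold commutators at 1 with a repeated function,
        \<open>f\<close> above and \<open>\<pi> f\<close> below, so the injectivity statements are
        literally the same.\<close>
      moreover have "symbol K S k L (h \<circ> \<pi>) (sym_prod K (Omega K S (h \<circ> \<pi>)) (replicate k \<beta>))
          = symbol K T k L' h (sym_prod K (Omega K T h) (replicate k \<alpha>))"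
      proof -
        have gT: "g \<in> carrier T" using g(1) PT.I_iff by blast
        have "set (replicate k f) \<subseteq> carrier S" using f(1) by auto
        from val[OF this] show ?thesis
          unfolding \<beta>_def g(2) PS.symbol_power[OF Lle f(1)] PT.symbol_power[OF L'le gT]
          by (simp add: f(2))
      qed
      ultimately show "inj_on (\<lambda>c. c \<otimes>\<^bsub>K\<^esub> symbol K T k L' h
          (sym_prod K (Omega K T h) (replicate k \<alpha>))) (carrier K)" by simp
    qed
    ultimately show ?thesis by blast
  qed
  have "elliptic_ldo K T k L'" if "points K T \<noteq> {}"
    unfolding elliptic_ldo_def ldo_of_order_def using elliptic that L'le by blast
  with L'le show ?thesis by blast
qed

end
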